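(* Let $F=\mathbb F_q$ have characteristic different from $2$ and $3$, let $s\in F$, $n\in F^\times$ with $s^3\ne27n$. For a finite étale cubic $F$-algebra $B$, let $C_{s,n,B}$ be the smooth projective compactification of $\operatorname{Tr}_{B/F}(x)=s$, $\operatorname{Norm}_{B/F}(x)=n$. Let $E_{s,n}$ be the projective Weierstrass curve $V^2=s^2U^2-4U^3-4s^3n-27n^2+18sUn$ and $A_q(s,n)=\#E_{s,n}(F)-q-1$. If $\tau_B\in S_3$ is the Frobenius permutation of the three geometric embeddings of $B$, then $\#C_{s,n,B}(F)=q+1+\operatorname{sgn}(\tau_B)A_q(s,n)$, and \[ N_B(s,n)=\#\{x\in B^\times:\operatorname{Tr}(x)=s,\operatorname{Norm}(x)=n\}=q+1+\operatorname{sgn}(\tau_B)A_q(s,n)-\#\operatorname{Fix}_{\{1,2,3\}}(\tau_B). \] Equivalently, $N_B(s,n)$ equals $\#E_{s,n}(F)-3$ for $B=F^3$, $2q+1-\#E_{s,n}(F)$ for $B=F\times\mathbb F_{q^2}$, and $\#E_{s,n}(F)$ for $B=\mathbb F_{q^3}$. *)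

theory Defs
  imports
    "HOL-Analysis.Analysis"
    "HOL-Algebra.Algebraic_Closure_Type"
    "HOL-Combinatorics.Permutations"
begin

unbundle no fps_syntax

text \<open>
  An algebra \<open>B\<close> over the field \<open>F = 'a\<close> is a commutative ring type \<open>'b\<close> together with its structure
  homomorphism \<open>\<iota> :: 'a \<Rightarrow> 'b\<close>; scalar multiplication is \<open>\<lambda>a x. \<iota> a * x\<close>.
\<close>

definition unital_hom :: "('a::comm_ring_1 \<Rightarrow> 'b::comm_ring_1) \<Rightarrow> bool" where
  "unital_hom f \<longleftrightarrow>
     f 1 = 1 \<and> (\<forall>x y. f (x + y) = f x + f y) \<and> (\<forall>x y. f (x * y) = f x * f y)"

definition algebra_hom ::
    "('a::field \<Rightarrow> 'b::comm_ring_1) \<Rightarrow> ('a \<Rightarrow> 'c::comm_ring_1) \<Rightarrow> ('b \<Rightarrow> 'c) \<Rightarrow> bool" where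
  "algebra_hom \<iota> h f \<longleftrightarrow> unital_hom f \<and> (\<forall>a. f (\<iota> a) = h a)"

definition is_basis3 :: "('a::field \<Rightarrow> 'b::comm_ring_1) \<Rightarrow> (3 \<Rightarrow> 'b) \<Rightarrow> bool" where
  "is_basis3 \<iota> b \<longleftrightarrow> (\<forall>x. \<exists>!c :: 'a^3. x = (\<Sum>i\<in>UNIV. \<iota> (c$i) * b i))"

text \<open>
  Trace and norm are those of the multiplication endomorphism of \<open>B\<close>, computed in a chosen basis (they
  do not depend on the choice).
\<close>

definition basis3 :: "('a::field \<Rightarrow> 'b::comm_ring_1) \<Rightarrow> 3 \<Rightarrow> 'b" where
  "basis3 \<iota> = (SOME b. is_basis3 \<iota> b)"

definition coords :: "('a::field \<Rightarrow> 'b::comm_ring_1) \<Rightarrow> 'b \<Rightarrow> 'a^3" where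
  "coords \<iota> x = (THE c. x = (\<Sum>i\<in>UNIV. \<iota> (c$i) * basis3 \<iota> i))"

definition mult_matrix :: "('a::field \<Rightarrow> 'b::comm_ring_1) \<Rightarrow> 'b \<Rightarrow> 'a^3^3" where
  "mult_matrix \<iota> x = (\<chi> i j. coords \<iota> (x * basis3 \<iota> j) $ i)"

definition alg_trace :: "('a::field \<Rightarrow> 'b::comm_ring_1) \<Rightarrow> 'b \<Rightarrow> 'a" where
  "alg_trace \<iota> x = trace (mult_matrix \<iota> x)"

definition alg_norm :: "('a::field \<Rightarrow> 'b::comm_ring_1) \<Rightarrow> 'b \<Rightarrow> 'a" where
  "alg_norm \<iota> x = det (mult_matrix \<iota> x)"

text \<open>
  For a ring homomorphism \<open>h :: 'a \<Rightarrow> 'r\<close>, the vector \<open>x :: 'r^3\<close> stands for the element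
  \<open>\<Sum>k. x$k \<otimes> basis3 \<iota> k\<close> of the base change \<open>'r \<otimes> B\<close>, and \<open>bc_matrix \<iota> h x\<close> is the matrix of
  multiplication by it. The product of \<open>x\<close> and \<open>y\<close> in \<open>'r \<otimes> B\<close> is thus \<open>bc_matrix \<iota> h x *v y\<close>.
\<close>

definition bc_matrix ::
    "('a::field \<Rightarrow> 'b::comm_ring_1) \<Rightarrow> ('a \<Rightarrow> 'r::comm_ring_1) \<Rightarrow> 'r^3 \<Rightarrow> 'r^3^3" where
  "bc_matrix \<iota> h x = (\<chi> i j. \<Sum>k\<in>UNIV. x$k * h (mult_matrix \<iota> (basis3 \<iota> k) $ i $ j))"

text \<open>
  A cubic algebra is etale if its base change to an algebraic closure \<open>K\<close> is isomorphic, as a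
  \<open>K\<close>-algebra, to \<open>K^3\<close> with componentwise operations.
\<close>

definition etale_cubic :: "('a::field \<Rightarrow> 'b::comm_ring_1) \<Rightarrow> bool" where
  "etale_cubic \<iota> \<longleftrightarrow>
     unital_hom \<iota> \<and> (\<exists>b. is_basis3 \<iota> b) \<and>
     (\<exists>\<phi> :: ('a alg_closure)^3 \<Rightarrow> ('a alg_closure)^3.
        bij \<phi> \<and> Vector_Spaces.linear (*s) (*s) \<phi> \<and>
        \<phi> (\<chi> i. to_ac (coords \<iota> 1 $ i)) = 1 \<and>
        (\<forall>x y. \<phi> (bc_matrix \<iota> to_ac x *v y) = \<phi> x * \<phi> y))"

definition geom_embeddings :: "('a::field \<Rightarrow> 'b::comm_ring_1) \<Rightarrow> ('b \<Rightarrow> 'a alg_closure) set" where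
  "geom_embeddings \<iota> = {\<sigma>. algebra_hom \<iota> to_ac \<sigma>}"

definition frob_perm ::
    "('a::{field,finite} \<Rightarrow> 'b::comm_ring_1) \<Rightarrow> ('b \<Rightarrow> 'a alg_closure) \<Rightarrow> ('b \<Rightarrow> 'a alg_closure)" where
  "frob_perm \<iota> = restrict_id (\<lambda>\<sigma> x. \<sigma> x ^ CARD('a)) (geom_embeddings \<iota>)"

definition proj_points :: "('k::field \<Rightarrow> 'v \<Rightarrow> 'v::zero) \<Rightarrow> ('v \<Rightarrow> bool) \<Rightarrow> 'v set set" where
  "proj_points sc P = {{sc c v |c. c \<noteq> 0} |v. v \<noteq> 0 \<and> P v}"

text \<open>
  The curve \<open>Tr(x) = s\<close>, \<open>Norm(x) = n\<close> is compactified inside the projective space of \<open>B \<oplus> F\<close>, with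
  homogeneous coordinates \<open>(x, z)\<close>, by \<open>Tr(x) = s z\<close>, \<open>Norm(x) = n z^3\<close>. The two defining forms can be
  evaluated over any \<open>F\<close>-algebra \<open>h :: 'a \<Rightarrow> 'r\<close>.
\<close>

definition curve_forms ::
    "('a::field \<Rightarrow> 'b::comm_ring_1) \<Rightarrow> ('a \<Rightarrow> 'r::comm_ring_1) \<Rightarrow> 'a \<Rightarrow> 'a
      \<Rightarrow> ('r^3) \<times> 'r \<Rightarrow> 'r \<times> 'r" where
  "curve_forms \<iota> h s n = (\<lambda>(x, z).
     (trace (bc_matrix \<iota> h x) - h s * z, det (bc_matrix \<iota> h x) - h n * z ^ 3))"

definition curve_points ::
    "('a::field \<Rightarrow> 'b::comm_ring_1) \<Rightarrow> ('a \<Rightarrow> 'k::field) \<Rightarrow> 'a \<Rightarrow> 'a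
      \<Rightarrow> (('k^3) \<times> 'k) set set" where
  "curve_points \<iota> h s n =
     proj_points (\<lambda>c (x, z). (c *s x, c * z)) (\<lambda>v. curve_forms \<iota> h s n v = 0)"

text \<open>
  The differential of the two forms at \<open>(x, z)\<close> in direction \<open>(y, w)\<close>: the coefficient of \<open>t\<close> in
  their values at \<open>(x + t y, z + t w)\<close> over \<open>K[t]\<close>.
\<close>

definition curve_differential ::
    "('a::field \<Rightarrow> 'b::comm_ring_1) \<Rightarrow> 'a \<Rightarrow> 'a \<Rightarrow> (('a alg_closure)^3) \<times> 'a alg_closure
      \<Rightarrow> (('a alg_closure)^3) \<times> 'a alg_closure \<Rightarrow> 'a alg_closure \<times> 'a alg_closure" where
  "curve_differential \<iota> s n = (\<lambda>(x, z) (y, w).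
     map_prod (\<lambda>p. Polynomial.coeff p 1) (\<lambda>p. Polynomial.coeff p 1)
       (curve_forms \<iota> (\<lambda>a. [:to_ac a:]) s n ((\<chi> i. [:x$i, y$i:]), [:z, w:])))"

inductive homogeneous_form :: "nat \<Rightarrow> (('k::field^3) \<times> 'k \<Rightarrow> 'k) \<Rightarrow> bool" where
  const: "homogeneous_form 0 (\<lambda>_. c)"
| coord: "homogeneous_form 1 (\<lambda>v. fst v $ i)"
| last_coord: "homogeneous_form 1 snd"
| add: "homogeneous_form d f \<Longrightarrow> homogeneous_form d g \<Longrightarrow> homogeneous_form d (\<lambda>v. f v + g v)"
| mult: "homogeneous_form d f \<Longrightarrow> homogeneous_form e g \<Longrightarrow> homogeneous_form (d + e) (\<lambda>v. f v * g v)"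

text \<open>
  The projective curve is the smooth projective compactification of its affine part \<open>z = 1\<close>: the
  Jacobian criterion (rank \<open>2\<close> in projective \<open>3\<close>-space) holds at every geometric point, and the
  affine part is Zariski dense.
\<close>

definition smooth_compactification :: "('a::field \<Rightarrow> 'b::comm_ring_1) \<Rightarrow> 'a \<Rightarrow> 'a \<Rightarrow> bool" where
  "smooth_compactification \<iota> s n \<longleftrightarrow>
     (\<forall>v. v \<noteq> 0 \<and> curve_forms \<iota> to_ac s n v = 0 \<longrightarrow> surj (curve_differential \<iota> s n v)) \<and>
     (\<forall>d f. homogeneous_form d f \<and> (\<forall>x. curve_forms \<iota> to_ac s n (x, 1) = 0 \<longrightarrow> f (x, 1) = 0) \<longrightarrow>
        (\<forall>v. v \<noteq> 0 \<and> curve_forms \<iota> to_ac s n v = 0 \<longrightarrow> f v = 0))"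

text \<open>Homogeneous coordinates \<open>(U : V : W)\<close>, with \<open>U = v$1\<close>, \<open>V = v$2\<close>, \<open>W = v$3\<close>.\<close>

definition weierstrass_points :: "'a::field \<Rightarrow> 'a \<Rightarrow> ('a^3) set set" where
  "weierstrass_points s n = proj_points (*s) (\<lambda>v.
     (v$2)^2 * v$3 = s^2 * (v$1)^2 * v$3 - 4 * (v$1)^3 - 4 * s^3 * n * (v$3)^3
       - 27 * n^2 * (v$3)^3 + 18 * s * v$1 * n * (v$3)^2)"

definition A_q :: "'a::{field,finite} \<Rightarrow> 'a \<Rightarrow> int" where
  "A_q s n = int (card (weierstrass_points s n)) - int CARD('a) - 1"

definition N_B :: "('a::{field,finite} \<Rightarrow> 'b::comm_ring_1) \<Rightarrow> 'a \<Rightarrow> 'a \<Rightarrow> nat" where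
  "N_B \<iota> s n = card {x. x dvd 1 \<and> alg_trace \<iota> x = s \<and> alg_norm \<iota> x = n}"

text \<open>The field with \<open>q^k\<close> elements, as a subfield of the algebraic closure of \<open>'a\<close>, \<open>q = CARD('a)\<close>.\<close>

definition Fq_ext :: "nat \<Rightarrow> 'a::{field,finite} alg_closure set" where
  "Fq_ext k = {y. y ^ (CARD('a) ^ k) = y}"

definition iso_split :: "('a::{field,finite} \<Rightarrow> 'b::comm_ring_1) \<Rightarrow> bool" where
  "iso_split \<iota> \<longleftrightarrow> (\<exists>f g h. algebra_hom \<iota> id f \<and> algebra_hom \<iota> id g \<and> algebra_hom \<iota> id h \<and>
     bij (\<lambda>x. (f x, g x, h x)))"

definition iso_linear_quadratic :: "('a::{field,finite} \<Rightarrow> 'b::comm_ring_1) \<Rightarrow> bool" where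
  "iso_linear_quadratic \<iota> \<longleftrightarrow> (\<exists>f g. algebra_hom \<iota> id f \<and> algebra_hom \<iota> to_ac g \<and>
     bij_betw (\<lambda>x. (f x, g x)) UNIV (UNIV \<times> Fq_ext 2))"

definition iso_cubic_field :: "('a::{field,finite} \<Rightarrow> 'b::comm_ring_1) \<Rightarrow> bool" where
  "iso_cubic_field \<iota> \<longleftrightarrow> (\<exists>g. algebra_hom \<iota> to_ac g \<and> bij_betw g UNIV (Fq_ext 3))"

end

theory Submission
  imports Defs
begin

text \<open>
  Over the algebraic closure \<open>K\<close> of \<open>F\<close> the algebra \<open>B\<close> becomes \<open>K^3\<close>, and by Galois descent \<open>B\<close> is
  the set of triples on which Frobenius acts through \<open>\<tau>_B\<close>. A solution of \<open>Tr(x) = s\<close>,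
  \<open>Norm(x) = n\<close> is therefore an ordering of the roots of some cubic \<open>T^3 - s T^2 + U T - n\<close>, \<open>U \<in> F\<close>,
  for which Frobenius permutes the roots by \<open>\<tau>_B\<close>, while \<open>V^2 = disc\<close> detects whether Frobenius permutes
  the roots evenly. Let \<open>a\<close>, \<open>b\<close>, \<open>c\<close>, \<open>d\<close> be the numbers of \<open>U\<close> for which the cubic is split with
  distinct roots, linear times irreducible quadratic, irreducible, or has a double root. Then
  \<open>#E = 1 + 2a + 2c + d\<close>, and \<open>N_B\<close> is \<open>6a + 3d\<close>, \<open>2b + d\<close> or \<open>3c\<close> according to the type of \<open>B\<close>.
  Clearly \<open>a + b + c + d = q\<close>, and since every nonzero \<open>x \<in> F\<close> is a root of exactly one of the cubics,
  \<open>3a + b + 2d = q - 1\<close>. The resulting relation \<open>c = 2a + d + 1\<close> gives all three formulas, with no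
  appeal to isogenies. The points at infinity correspond to the embeddings fixed by Frobenius.
\<close>

section \<open>Frobenius on the algebraic closure of a finite field\<close>

text \<open>Multiplication by a nonzero \<open>x\<close> permutes the nonzero elements, so their
  product absorbs the factor \<open>x ^ (CARD('a) - 1)\<close>.\<close>

lemma finite_field_power_card:
  fixes x :: "'a::{field,finite}"
  shows "x ^ CARD('a) = x"
proof (cases "x = 0")
  case False
  have "(\<Prod>y\<in>UNIV-{0::'a}. x * y) = (\<Prod>y\<in>UNIV-{0::'a}. y)"
    by (rule prod.reindex_bij_betw, rule bij_betw_byWitness[where f' = "\<lambda>y. y / x"])
      (use False in auto)
  moreover have "(\<Prod>y\<in>UNIV-{0::'a}. x * y) = x ^ (CARD('a) - 1) * (\<Prod>y\<in>UNIV-{0::'a}. y)"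
    by (simp add: prod.distrib card_Diff_singleton)
  ultimately have "x ^ (CARD('a) - 1) = 1"
    by simp
  then show ?thesis
    by (metis One_nat_def mult.right_neutral power_Suc Suc_pred zero_less_card_finite)
qed (simp add: zero_power)

lemma card_field_ge_2: "CARD('a::{field,finite}) \<ge> 2"
proof -
  have "card {0::'a, 1} \<le> CARD('a)"
    by (rule card_mono) auto
  then show ?thesis by simp
qed

text \<open>The polynomial (X+1)^q - X^q - 1 has degree below q and vanishes at all q elements of F,
  so its coefficients are zero. This yields additivity of Frobenius without writing q as a prime
  power.\<close>

lemma finite_field_binomial_card_eq_0:
  assumes "0 < k" "k < CARD('a::{field,finite})"
  shows "of_nat (CARD('a) choose k) = (0::'a)"
proof -
  define q where "q = CARD('a)"
  have q: "q \<ge> 2" using card_field_ge_2[where 'a='a] by (simp add: q_def)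
  define p where "p = (\<Sum>k\<in>{0<..<q}. Polynomial.monom (of_nat (q choose k) :: 'a) k)"
  have "poly p x = 0" for x
  proof -
    have "{..q} = insert 0 (insert q {0<..<q})" using q by auto
    then have "(x + 1) ^ q = 1 + x ^ q + poly p x"
      using q by (simp add: binomial_ring p_def poly_sum poly_monom)
    then show ?thesis
      using finite_field_power_card[of x] finite_field_power_card[of "x + 1"] by (simp add: q_def)
  qed
  then have roots: "{x. poly p x = 0} = UNIV" by auto
  have "Polynomial.degree p \<le> q - 1"
    unfolding p_def by (rule degree_sum_le) (auto intro: order_trans[OF degree_monom_le])
  with q have "Polynomial.degree p < q" by simp
  then have "p = 0"
    using card_poly_roots_bound[of p] roots by (cases "p = 0") (auto simp: q_def)
  then have "Polynomial.coeff p k = 0" by simp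
  then show ?thesis
    using assms by (simp add: p_def coeff_sum q_def sum.delta' cong: if_cong)
qed

lemma frob_add:
  fixes x y :: "'a::{field,finite} alg_closure"
  shows "(x + y) ^ CARD('a) = x ^ CARD('a) + y ^ CARD('a)"
proof -
  define q where "q = CARD('a)"
  have q: "q \<ge> 2" using card_field_ge_2[where 'a='a] by (simp add: q_def)
  have "of_nat (q choose k) = (0 :: 'a alg_closure)" if "0 < k" "k < q" for k
    using finite_field_binomial_card_eq_0[where 'a='a, of k] that
    by (metis q_def to_ac_0 to_ac_of_nat)
  moreover have "{..q} = insert 0 (insert q {0<..<q})" using q by auto
  ultimately have "(x + y) ^ q = x ^ q + y ^ q"
    using q by (simp add: binomial_ring add.commute)
  then show ?thesis by (simp add: q_def)
qed

lemma frob_sum: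
  fixes f :: "'i \<Rightarrow> 'a::{field,finite} alg_closure"
  shows "(\<Sum>i\<in>A. f i) ^ CARD('a) = (\<Sum>i\<in>A. f i ^ CARD('a))"
  by (induction A rule: infinite_finite_induct) (auto simp: frob_add zero_power)

lemma frob_minus:
  fixes x :: "'a::{field,finite} alg_closure"
  shows "(- x) ^ CARD('a) = - (x ^ CARD('a))"
  using frob_add[of x "- x"] by (simp add: zero_power eq_neg_iff_add_eq_0 add.commute)

lemma frob_diff:
  fixes x y :: "'a::{field,finite} alg_closure"
  shows "(x - y) ^ CARD('a) = x ^ CARD('a) - y ^ CARD('a)"
  using frob_add[of x "- y"] by (simp add: frob_minus)

lemma frob_eq_iff:
  fixes x y :: "'a::{field,finite} alg_closure"
  shows "x ^ CARD('a) = y ^ CARD('a) \<longleftrightarrow> x = y"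
  using frob_diff[of x y] by auto

lemma frob_to_ac: "to_ac (a::'a::{field,finite}) ^ CARD('a) = to_ac a"
  by (metis finite_field_power_card to_ac_power)

text \<open>F supplies q roots of X^q - X, which has no more than q. This is the descent criterion
  from the closure to F used throughout.\<close>

lemma frob_fixed_iff:
  fixes y :: "'a::{field,finite} alg_closure"
  shows "y ^ CARD('a) = y \<longleftrightarrow> y \<in> range to_ac"
proof -
  define q where "q = CARD('a)"
  have q: "q \<ge> 2" using card_field_ge_2[where 'a='a] by (simp add: q_def)
  define p where "p = Polynomial.monom (1 :: 'a alg_closure) q - Polynomial.monom 1 1"
  have "Polynomial.coeff p q = 1" using q by (simp add: p_def)
  then have p0: "p \<noteq> 0" by auto
  have "Polynomial.degree p \<le> q"
    unfolding p_def using q by (intro degree_diff_le) (auto simp: degree_monom_eq)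
  then have le: "card {x. poly p x = 0} \<le> q"
    using card_poly_roots_bound[OF p0] by simp
  have "range to_ac \<subseteq> {x. poly p x = 0}"
    by (auto simp: p_def poly_monom q_def frob_to_ac)
  moreover have "card (range (to_ac :: 'a \<Rightarrow> _)) = q"
    by (simp add: card_image inj_to_ac q_def)
  ultimately have "range to_ac = {x. poly p x = 0}"
    using le poly_roots_finite[OF p0] by (intro card_seteq) auto
  then show ?thesis
    by (auto simp: p_def poly_monom q_def)
qed

text \<open>Euclid's argument: over a finite field, 1 plus the product of all X - a is a nonconstant
  polynomial without roots.\<close>

lemma infinite_alg_closed_field: "infinite (UNIV :: 'k::alg_closed_field set)"
proof
  assume fin: "finite (UNIV :: 'k set)"
  define p where "p = (\<Prod>a\<in>UNIV. [:- a, 1::'k:]) + 1"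
  have "card {0::'k, 1} \<le> CARD('k)"
    by (rule card_mono) (use fin in auto)
  then have "Polynomial.degree (\<Prod>a\<in>UNIV. [:- a, 1::'k:]) \<ge> 2"
    by (subst degree_prod_eq_sum_degree) auto
  then have "Polynomial.degree p > 0"
    unfolding p_def by (subst degree_add_eq_left) auto
  then obtain x where "poly p x = 0"
    using alg_closed_imp_poly_has_root by blast
  moreover have "poly p x = 1"
    using fin by (auto simp: p_def poly_prod)
  ultimately show False by simp
qed

lemma poly_eqI_infinite:
  fixes p r :: "'k::idom poly"
  assumes "infinite {x. poly p x = poly r x}"
  shows "p = r"
  using assms poly_roots_finite[of "p - r"] by fastforce

section \<open>Roots of a cubic under Frobenius\<close>

text \<open>By Vieta \<open>u\<close> is a root of (X-a)(X-b)(X-c). Removing the root it equals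
  leaves the same question for two elements, settled by \<open>two\<close>.\<close>

lemma symmetric3_eq_cases:
  fixes a b c u v w :: "'k::idom"
  assumes "u + v + w = a + b + c" "u * v + v * w + w * u = a * b + b * c + c * a" "u * v * w = a * b * c"
  shows "(u, v, w) \<in> {(a, b, c), (a, c, b), (b, a, c), (b, c, a), (c, a, b), (c, b, a)}"
proof -
  have two: "v = y \<and> w = z \<or> v = z \<and> w = y" if "v + w = y + z" "v * w = y * z" for y z
  proof -
    have "(v - y) * (v - z) = v * v - v * (y + z) + y * z" by (simp add: algebra_simps)
    also have "\<dots> = 0" unfolding that [symmetric] by (simp add: algebra_simps)
    finally show ?thesis using that by auto
  qed
  have "(u - a) * (u - b) * (u - c) =
      u ^ 3 - (a + b + c) * u ^ 2 + (a * b + b * c + c * a) * u - a * b * c"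
    by (simp add: power2_eq_square power3_eq_cube algebra_simps)
  also have "\<dots> = 0"
    unfolding assms [symmetric] by (simp add: power2_eq_square power3_eq_cube algebra_simps)
  finally consider "u = a" | "u = b" | "u = c" by auto
  then show ?thesis
  proof cases
    case 1
    with assms have "v + w = b + c" by simp
    moreover have "a * (v + w) + v * w = a * (b + c) + b * c"
      using assms(2) 1 by (simp add: algebra_simps)
    ultimately have "v + w = b + c" "v * w = b * c" by simp_all
    from two[OF this] 1 show ?thesis by auto
  next
    case 2
    with assms have "v + w = a + c" by (simp add: ac_simps)
    moreover have "b * (v + w) + v * w = b * (a + c) + a * c"
      using assms(2) 2 by (simp add: algebra_simps)
    ultimately have "v + w = a + c" "v * w = a * c" by simp_all
    from two[OF this] 2 show ?thesis by auto
  next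
    case 3
    with assms have "v + w = a + b" by (simp add: ac_simps)
    moreover have "c * (v + w) + v * w = c * (a + b) + a * b"
      using assms(2) 3 by (simp add: algebra_simps)
    ultimately have "v + w = a + b" "v * w = a * b" by simp_all
    from two[OF this] 3 show ?thesis by auto
  qed
qed

text \<open>By Vieta, the orderings of the roots of T^3 - s T^2 + t T - n. Distinct roots give six
  triples, a double root beside a simple one gives three.\<close>

definition root_triples :: "'k::comm_ring_1 \<Rightarrow> 'k \<Rightarrow> 'k \<Rightarrow> ('k \<times> 'k \<times> 'k) set" where
  "root_triples s t n = {(u, v, w). u + v + w = s \<and> u * v + v * w + w * u = t \<and> u * v * w = n}"

lemma root_triples_eq:
  fixes a b c :: "'k::idom"
  assumes "(a, b, c) \<in> root_triples s t n"
  shows "root_triples s t n = {(a, b, c), (a, c, b), (b, a, c), (b, c, a), (c, a, b), (c, b, a)}"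
proof (rule equalityI)
  show "root_triples s t n \<subseteq> {(a, b, c), (a, c, b), (b, a, c), (b, c, a), (c, a, b), (c, b, a)}"
  proof
    fix x assume x: "x \<in> root_triples s t n"
    obtain u v w where uvw: "x = (u, v, w)" by (cases x)
    show "x \<in> {(a, b, c), (a, c, b), (b, a, c), (b, c, a), (c, a, b), (c, b, a)}"
      unfolding uvw by (rule symmetric3_eq_cases)
        (use x assms in \<open>auto simp: uvw root_triples_def\<close>)
  qed
  show "{(a, b, c), (a, c, b), (b, a, c), (b, c, a), (c, a, b), (c, b, a)} \<subseteq> root_triples s t n"
    using assms by (auto simp: root_triples_def algebra_simps)
qed

lemma root_triples_nonempty:
  fixes s t n :: "'k::alg_closed_field"
  shows "\<exists>a b c. (a, b, c) \<in> root_triples s t n"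
proof -
  have "\<exists>a. poly [:- n, t, - s, 1:] a = 0"
    by (rule alg_closed_imp_poly_has_root) simp
  then obtain a where a: "poly [:- n, t, - s, 1:] a = 0" by blast
  \<comment> \<open>This quadratic is the quotient of the cubic by X - a.\<close>
  have "\<exists>b. poly [:t - a * (s - a), - (s - a), 1:] b = 0"
    by (rule alg_closed_imp_poly_has_root) simp
  then obtain b where b: "poly [:t - a * (s - a), - (s - a), 1:] b = 0" by blast
  have bc: "b * (s - a - b) = t - a * (s - a)"
    using b by (simp add: algebra_simps)
  have "a * b * (s - a - b) = a * (t - a * (s - a))"
    using bc by (simp add: mult.assoc)
  also have "\<dots> = n"
    using a by (simp add: algebra_simps)
  finally have "(a, b, s - a - b) \<in> root_triples s t n"
    using bc by (simp add: root_triples_def algebra_simps)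
  then show ?thesis by blast
qed

lemma root_triples_to_ac_frob:
  fixes s t n :: "'a::{field,finite}"
  assumes "(a, b, c) \<in> root_triples (to_ac s) (to_ac t) (to_ac n)"
  shows "(a ^ CARD('a), b ^ CARD('a), c ^ CARD('a)) \<in> root_triples (to_ac s) (to_ac t) (to_ac n)"
proof -
  have "(a + b + c) ^ CARD('a) = to_ac s" "(a * b + b * c + c * a) ^ CARD('a) = to_ac t"
    "(a * b * c) ^ CARD('a) = to_ac n"
    using assms by (simp_all add: root_triples_def frob_to_ac)
  then show ?thesis
    by (simp add: root_triples_def frob_add power_mult_distrib)
qed

text \<open>The cases are the factorization types over F: three linear factors, linear times
  irreducible quadratic, irreducible, and a double root. A triple root y would give s = 3y and n =
  y^3, which the hypothesis excludes.\<close>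

lemma root_triples_frob_cases:
  fixes s t n :: "'a::{field,finite}"
  assumes "s ^ 3 \<noteq> 27 * n"
  obtains (split) a b c where "(a, b, c) \<in> root_triples (to_ac s) (to_ac t) (to_ac n)"
      "a \<noteq> b" "b \<noteq> c" "a \<noteq> c" "a ^ CARD('a) = a" "b ^ CARD('a) = b" "c ^ CARD('a) = c"
    | (swap) a b c where "(a, b, c) \<in> root_triples (to_ac s) (to_ac t) (to_ac n)"
      "a \<noteq> b" "b \<noteq> c" "a \<noteq> c" "a ^ CARD('a) = a" "b ^ CARD('a) = c" "c ^ CARD('a) = b"
    | (cycle) a b c where "(a, b, c) \<in> root_triples (to_ac s) (to_ac t) (to_ac n)"
      "a \<noteq> b" "b \<noteq> c" "a \<noteq> c" "a ^ CARD('a) = b" "b ^ CARD('a) = c" "c ^ CARD('a) = a"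
    | (double) a b where "(a, a, b) \<in> root_triples (to_ac s) (to_ac t) (to_ac n)"
      "a \<noteq> b" "a ^ CARD('a) = a" "b ^ CARD('a) = b"
proof -
  define R where "R = root_triples (to_ac s) (to_ac t) (to_ac n)"
  obtain a b c where abc: "(a, b, c) \<in> R"
    using root_triples_nonempty[of "to_ac s" "to_ac t" "to_ac n"] by (auto simp: R_def)
  have perms: "R = {(a, b, c), (a, c, b), (b, a, c), (b, c, a), (c, a, b), (c, b, a)}"
    unfolding R_def by (rule root_triples_eq) (use abc in \<open>simp add: R_def\<close>)
  have frob: "(a ^ CARD('a), b ^ CARD('a), c ^ CARD('a)) \<in> R" if "(a, b, c) \<in> R" for a b c
    unfolding R_def by (rule root_triples_to_ac_frob) (use that in \<open>simp add: R_def\<close>)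
  have dbl: thesis if xy: "(x, x, y) \<in> R" for x y
  proof -
    have "x \<noteq> y"
    proof
      assume "x = y"
      with xy have "to_ac s = 3 * y" "to_ac n = y ^ 3"
        by (auto simp: R_def root_triples_def power3_eq_cube)
      then have "to_ac (s ^ 3) = to_ac (27 * n)"
        by (simp add: power_mult_distrib)
      then have "s ^ 3 = 27 * n" by (simp only: to_ac_eq_iff)
      with assms show False ..
    qed
    \<comment> \<open>Roots of different multiplicity cannot be exchanged, so Frobenius fixes
      both.\<close>
    moreover have "R = {(x, x, y), (x, y, x), (y, x, x)}"
      using root_triples_eq[OF xy[unfolded R_def]] by (auto simp: R_def)
    with frob[OF xy] have "x ^ CARD('a) = x" "y ^ CARD('a) = y"
      using \<open>x \<noteq> y\<close> by auto
    ultimately show thesis using xy double by (simp add: R_def)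
  qed
  show thesis
  proof (cases "a \<noteq> b \<and> b \<noteq> c \<and> a \<noteq> c")
    case False
    then consider "(a, a, c) \<in> R" | "(b, b, a) \<in> R" | "(a, a, b) \<in> R"
      using perms by auto
    then show thesis by cases (auto intro: dbl)
  next
    case True
    have mem: "(a, b, c) \<in> R" "(a, c, b) \<in> R" "(b, a, c) \<in> R" "(b, c, a) \<in> R" "(c, a, b) \<in> R" "(c, b, a) \<in> R"
      using perms by auto
    note mem = this[unfolded R_def]
    \<comment> \<open>Frobenius induces one of six permutations of the roots; relabelling brings the
      three transpositions to \<open>swap\<close> and the two 3-cycles to
      \<open>cycle\<close>.\<close>
    from frob[OF abc] consider
        "a ^ CARD('a) = a" "b ^ CARD('a) = b" "c ^ CARD('a) = c"
      | "a ^ CARD('a) = a" "b ^ CARD('a) = c" "c ^ CARD('a) = b"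
      | "a ^ CARD('a) = b" "b ^ CARD('a) = a" "c ^ CARD('a) = c"
      | "a ^ CARD('a) = b" "b ^ CARD('a) = c" "c ^ CARD('a) = a"
      | "a ^ CARD('a) = c" "b ^ CARD('a) = a" "c ^ CARD('a) = b"
      | "a ^ CARD('a) = c" "b ^ CARD('a) = b" "c ^ CARD('a) = a"
      unfolding perms by auto
    then show thesis
    proof cases
      case 1 then show thesis using split[OF mem(1)] True by blast
    next
      case 2 then show thesis using swap[OF mem(1)] True by blast
    next
      case 3 then show thesis using swap[OF mem(5)] True by metis
    next
      case 4 then show thesis using cycle[OF mem(1)] True by metis
    next
      case 5 then show thesis using cycle[OF mem(2)] True by metis
    next
      case 6 then show thesis using swap[OF mem(3)] True by metis
    qed
  qed
qed

text \<open>The discriminant of T^3 - s T^2 + t T - n. It is also the right-hand side of the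
  Weierstrass equation at U = t, W = 1, which links orderings of roots to points of E.\<close>

definition cubic_disc :: "'k::comm_ring_1 \<Rightarrow> 'k \<Rightarrow> 'k \<Rightarrow> 'k" where
  "cubic_disc s n t = s^2 * t^2 - 4 * t^3 - 4 * s^3 * n - 27 * n^2 + 18 * s * t * n"

lemma cubic_disc_eq:
  assumes "(a, b, c) \<in> root_triples s t n"
  shows "cubic_disc s n t = ((a - b) * (b - c) * (c - a))\<^sup>2"
proof -
  have "s = a + b + c" "t = a * b + b * c + c * a" "n = a * b * c"
    using assms by (auto simp: root_triples_def)
  then show ?thesis unfolding cubic_disc_def
    by (simp add: power2_eq_square power3_eq_cube algebra_simps)
qed

lemma card_to_ac_image:
  "card {x::'a::{field,finite}. P (to_ac x)} = card {y. y ^ CARD('a) = y \<and> P y}"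
proof -
  have "{y. y ^ CARD('a) = y \<and> P y} = to_ac ` {x::'a. P (to_ac x)}"
    by (auto simp: frob_fixed_iff)
  then show ?thesis
    by (simp add: card_image inj_on_def)
qed

text \<open>In the order split, swap, cycle, double, the values of (t1, t2, t3, e, r) are
  (6,0,0,2,3), (0,2,0,0,1), (0,0,3,2,0) and (3,1,0,1,2). The three relations are linear identities
  satisfied by all four rows, so they can be summed over \<open>t\<close> without knowing how often
  each type occurs.\<close>

lemma root_counts:
  fixes s t n :: "'a::{field,finite}"
  assumes "s ^ 3 \<noteq> 27 * n" and two: "(2::'a) \<noteq> 0"
  defines "R \<equiv> root_triples (to_ac s) (to_ac t) (to_ac n)"
  defines "t1 \<equiv> card {(u, v, w) \<in> R. u ^ CARD('a) = u \<and> v ^ CARD('a) = v \<and> w ^ CARD('a) = w}"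
    and "t2 \<equiv> card {(u, v, w) \<in> R. u ^ CARD('a) = u \<and> v ^ CARD('a) = w \<and> w ^ CARD('a) = v}"
    and "t3 \<equiv> card {(u, v, w) \<in> R. u ^ CARD('a) = v \<and> v ^ CARD('a) = w \<and> w ^ CARD('a) = u}"
    and "e \<equiv> card {V. V\<^sup>2 = cubic_disc s n t}"
    and "r \<equiv> card {x. x ^ 3 - s * x\<^sup>2 + t * x - n = 0}"
  shows "t2 + e = 2" "t3 + 3 * r = t1 + 3" "t1 + 2 * t3 = 3 * e"
proof -
  have two': "(2::'a alg_closure) \<noteq> 0"
    by (metis two to_ac_eq_0_iff to_ac_numeral)
  have "e = card {V. to_ac V ^ 2 = cubic_disc (to_ac s) (to_ac n) (to_ac t)}"
    unfolding e_def to_ac_eq_iff[of _ "cubic_disc s n t", symmetric] by (simp add: cubic_disc_def)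
  then have e: "e = card {V. V ^ CARD('a) = V \<and> V ^ 2 = cubic_disc (to_ac s) (to_ac n) (to_ac t)}"
    by (simp only: card_to_ac_image[where P = "\<lambda>V. V\<^sup>2 = cubic_disc (to_ac s) (to_ac n) (to_ac t)"])
  have "r = card {x. to_ac x ^ 3 - to_ac s * to_ac x ^ 2 + to_ac t * to_ac x - to_ac n = 0}"
    unfolding r_def to_ac_eq_iff[of _ "0::'a", symmetric] by simp
  then have r: "r = card {x. x ^ CARD('a) = x \<and> x ^ 3 - to_ac s * x ^ 2 + to_ac t * x - to_ac n = 0}"
    by (simp only: card_to_ac_image[where P = "\<lambda>x. x ^ 3 - to_ac s * x ^ 2 + to_ac t * x - to_ac n = 0"])
  have r': "r = card {x. x ^ CARD('a) = x \<and> (x = a \<or> x = b \<or> x = c)}" if "(a, b, c) \<in> R" for a b c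
  proof -
    have "to_ac s = a + b + c" "to_ac t = a * b + b * c + c * a" "to_ac n = a * b * c"
      using that by (auto simp: R_def root_triples_def)
    then have "x ^ 3 - to_ac s * x ^ 2 + to_ac t * x - to_ac n = (x - a) * (x - b) * (x - c)" for x
      by (simp add: power2_eq_square power3_eq_cube algebra_simps)
    then show ?thesis unfolding r by simp
  qed
  \<comment> \<open>The square roots of the discriminant are d and -d, so \<open>e\<close> depends
    only on how Frobenius moves the difference product d.\<close>
  have e': "e = card {V. V ^ CARD('a) = V \<and> (V = d \<or> V = - d)}"
    if "(a, b, c) \<in> R" "d = (a - b) * (b - c) * (c - a)" for a b c d
    using cubic_disc_eq[of a b c "to_ac s" "to_ac t" "to_ac n"] that unfolding e R_def
    by (simp add: power2_eq_iff)
  \<comment> \<open>Characteristic different from 2 keeps d and -d apart when d is nonzero.\<close>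
  have neg: "x \<noteq> - x" if "x \<noteq> 0" for x :: "'a alg_closure"
    using that two' by (metis add.right_inverse mult_2 mult_eq_0_iff)
  note [simp] = frob_minus frob_diff power_mult_distrib
  have "t2 + e = 2 \<and> t3 + 3 * r = t1 + 3 \<and> t1 + 2 * t3 = 3 * e"
    using assms(1)
  proof (cases rule: root_triples_frob_cases[where t = t])
    case (split a b c)
    note abc = split(1)[folded R_def]
    have R: "R = {(a, b, c), (a, c, b), (b, a, c), (b, c, a), (c, a, b), (c, b, a)}"
      unfolding R_def by (rule root_triples_eq[OF split(1)])
    have "{(u, v, w) \<in> R. u ^ CARD('a) = u \<and> v ^ CARD('a) = v \<and> w ^ CARD('a) = w} = R"
      using split unfolding R by auto
    then have "t1 = 6" unfolding t1_def using split by (simp add: R)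
    moreover have "{(u, v, w) \<in> R. u ^ CARD('a) = u \<and> v ^ CARD('a) = w \<and> w ^ CARD('a) = v} = {}"
      using split unfolding R by auto
    then have "t2 = 0" unfolding t2_def by (simp only: card.empty)
    moreover have "{(u, v, w) \<in> R. u ^ CARD('a) = v \<and> v ^ CARD('a) = w \<and> w ^ CARD('a) = u} = {}"
      using split unfolding R by auto
    then have "t3 = 0" unfolding t3_def by (simp only: card.empty)
    moreover have "{x. x ^ CARD('a) = x \<and> (x = a \<or> x = b \<or> x = c)} = {a, b, c}"
      using split by auto
    then have "r = 3" unfolding r'[OF abc] using split by simp
    moreover have "e = 2"
    proof -
      define d where "d = (a - b) * (b - c) * (c - a)"
      have "d \<noteq> 0" "d ^ CARD('a) = d" using split by (auto simp: d_def)
      then have "{V. V ^ CARD('a) = V \<and> (V = d \<or> V = - d)} = {d, - d}" by auto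
      then show ?thesis
        using e'[OF abc d_def] neg[OF \<open>d \<noteq> 0\<close>] by simp
    qed
    ultimately show ?thesis by simp
  next
    case (swap a b c)
    note abc = swap(1)[folded R_def]
    have R: "R = {(a, b, c), (a, c, b), (b, a, c), (b, c, a), (c, a, b), (c, b, a)}"
      unfolding R_def by (rule root_triples_eq[OF swap(1)])
    have "{(u, v, w) \<in> R. u ^ CARD('a) = u \<and> v ^ CARD('a) = v \<and> w ^ CARD('a) = w} = {}"
      using swap unfolding R by auto
    then have "t1 = 0" unfolding t1_def by (simp only: card.empty)
    moreover have "{(u, v, w) \<in> R. u ^ CARD('a) = u \<and> v ^ CARD('a) = w \<and> w ^ CARD('a) = v}
        = {(a, b, c), (a, c, b)}"
      using swap unfolding R by auto
    then have "t2 = 2" unfolding t2_def using swap by simp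
    moreover have "{(u, v, w) \<in> R. u ^ CARD('a) = v \<and> v ^ CARD('a) = w \<and> w ^ CARD('a) = u} = {}"
      using swap unfolding R by auto
    then have "t3 = 0" unfolding t3_def by (simp only: card.empty)
    moreover have "{x. x ^ CARD('a) = x \<and> (x = a \<or> x = b \<or> x = c)} = {a}"
      using swap by auto
    then have "r = 1" unfolding r'[OF abc] by simp
    moreover have "e = 0"
    proof -
      define d where "d = (a - b) * (b - c) * (c - a)"
      have "d \<noteq> 0" using swap by (simp add: d_def)
      have "d ^ CARD('a) = (a ^ CARD('a) - b ^ CARD('a)) * (b ^ CARD('a) - c ^ CARD('a)) *
          (c ^ CARD('a) - a ^ CARD('a))"
        by (simp add: d_def)
      \<comment> \<open>An odd permutation of the roots negates d, so the discriminant is not a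
        square in F.\<close>
      also have "\<dots> = - d"
        unfolding swap(5-7) d_def by (simp add: algebra_simps)
      finally have "{V. V ^ CARD('a) = V \<and> (V = d \<or> V = - d)} = {}"
        using neg[OF \<open>d \<noteq> 0\<close>] by auto
      then show ?thesis
        using e'[OF abc d_def] by simp
    qed
    ultimately show ?thesis by simp
  next
    case (cycle a b c)
    note abc = cycle(1)[folded R_def]
    have R: "R = {(a, b, c), (a, c, b), (b, a, c), (b, c, a), (c, a, b), (c, b, a)}"
      unfolding R_def by (rule root_triples_eq[OF cycle(1)])
    have "{(u, v, w) \<in> R. u ^ CARD('a) = u \<and> v ^ CARD('a) = v \<and> w ^ CARD('a) = w} = {}"
      using cycle unfolding R by auto
    then have "t1 = 0" unfolding t1_def by (simp only: card.empty)
    moreover have "{(u, v, w) \<in> R. u ^ CARD('a) = u \<and> v ^ CARD('a) = w \<and> w ^ CARD('a) = v} = {}"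
      using cycle unfolding R by auto
    then have "t2 = 0" unfolding t2_def by (simp only: card.empty)
    moreover have "{(u, v, w) \<in> R. u ^ CARD('a) = v \<and> v ^ CARD('a) = w \<and> w ^ CARD('a) = u}
        = {(a, b, c), (b, c, a), (c, a, b)}"
      using cycle unfolding R by auto
    then have "t3 = 3" unfolding t3_def using cycle by simp
    moreover have "{x. x ^ CARD('a) = x \<and> (x = a \<or> x = b \<or> x = c)} = {}"
      using cycle by auto
    then have "r = 0" unfolding r'[OF abc] by simp
    moreover have "e = 2"
    proof -
      define d where "d = (a - b) * (b - c) * (c - a)"
      have "d \<noteq> 0" using cycle by (simp add: d_def)
      have "d ^ CARD('a) = (a ^ CARD('a) - b ^ CARD('a)) * (b ^ CARD('a) - c ^ CARD('a)) *
          (c ^ CARD('a) - a ^ CARD('a))"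
        by (simp add: d_def)
      \<comment> \<open>A 3-cycle is even and fixes d, so the discriminant is a nonzero square in
        F.\<close>
      also have "\<dots> = d"
        unfolding cycle(5-7) d_def by (simp add: algebra_simps)
      finally have "{V. V ^ CARD('a) = V \<and> (V = d \<or> V = - d)} = {d, - d}" by auto
      then show ?thesis
        using e'[OF abc d_def] neg[OF \<open>d \<noteq> 0\<close>] by simp
    qed
    ultimately show ?thesis by simp
  next
    case (double a b)
    note abc = double(1)[folded R_def]
    have R: "R = {(a, a, b), (a, b, a), (b, a, a)}"
      using root_triples_eq[OF double(1)] by (auto simp: R_def)
    have "{(u, v, w) \<in> R. u ^ CARD('a) = u \<and> v ^ CARD('a) = v \<and> w ^ CARD('a) = w} = R"
      using double unfolding R by auto
    then have "t1 = 3" unfolding t1_def using double by (simp add: R)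
    moreover have "{(u, v, w) \<in> R. u ^ CARD('a) = u \<and> v ^ CARD('a) = w \<and> w ^ CARD('a) = v}
        = {(b, a, a)}"
      using double unfolding R by auto
    then have "t2 = 1" unfolding t2_def by simp
    moreover have "{(u, v, w) \<in> R. u ^ CARD('a) = v \<and> v ^ CARD('a) = w \<and> w ^ CARD('a) = u} = {}"
      using double unfolding R by auto
    then have "t3 = 0" unfolding t3_def by (simp only: card.empty)
    moreover have "{x. x ^ CARD('a) = x \<and> (x = a \<or> x = a \<or> x = b)} = {a, b}"
      using double by auto
    then have "r = 2" unfolding r'[OF abc] using double by simp
    moreover have "{V :: 'a alg_closure. V ^ CARD('a) = V \<and> (V = 0 \<or> V = - 0)} = {0}"
      by auto
    then have "e = 1"
      using e'[OF abc refl] by simp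
    ultimately show ?thesis by simp
  qed
  then show "t2 + e = 2" "t3 + 3 * r = t1 + 3" "t1 + 2 * t3 = 3 * e" by auto
qed

section \<open>Counting triples and Weierstrass points\<close>

definition trace_norm_triples :: "'a::{field,finite} \<Rightarrow> 'a \<Rightarrow> ('a alg_closure \<times> 'a alg_closure \<times> 'a alg_closure) set" where
  "trace_norm_triples s n = {(u, v, w). u + v + w = to_ac s \<and> u * v * w = to_ac n}"

lemma finite_root_triples: "finite (root_triples s t (n :: 'k::idom))"
proof (cases "root_triples s t n = {}")
  case False
  then obtain a b c where "(a, b, c) \<in> root_triples s t n" by auto
  from root_triples_eq[OF this] show ?thesis by simp
qed simp

text \<open>The triples are sorted by their second elementary symmetric function. The premise says
  that Frobenius fixes it, so it is some \<open>t\<close> in F and the triple orders the roots of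
  the corresponding cubic.\<close>

lemma card_trace_norm_triples:
  fixes s n :: "'a::{field,finite}"
  assumes "\<And>u v w. (u, v, w) \<in> trace_norm_triples s n \<Longrightarrow> P u v w \<Longrightarrow>
      (u * v + v * w + w * u) ^ CARD('a) = u * v + v * w + w * u"
  shows "card {(u, v, w) \<in> trace_norm_triples s n. P u v w} =
    (\<Sum>t\<in>UNIV. card {(u, v, w) \<in> root_triples (to_ac s) (to_ac t) (to_ac n). P u v w})"
proof -
  let ?S = "\<lambda>t. {(u, v, w) \<in> root_triples (to_ac s) (to_ac t) (to_ac n). P u v w}"
  have "\<exists>t. u * v + v * w + w * u = to_ac t"
    if "(u, v, w) \<in> trace_norm_triples s n" "P u v w" for u v w
    using assms[OF that] by (auto simp: frob_fixed_iff)
  then have "{(u, v, w) \<in> trace_norm_triples s n. P u v w} = (\<Union>t\<in>UNIV. ?S t)"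
    by (auto simp: trace_norm_triples_def root_triples_def)
  also have "card \<dots> = (\<Sum>t\<in>UNIV. card (?S t))"
  proof (rule card_UN_disjoint)
    show "\<forall>t\<in>UNIV. finite (?S t)"
    proof
      fix t
      show "finite (?S t)"
        by (rule finite_subset[OF _ finite_root_triples[of "to_ac s" "to_ac t" "to_ac n"]]) auto
    qed
    show "\<forall>t\<in>UNIV. \<forall>t'\<in>UNIV. t \<noteq> t' \<longrightarrow> ?S t \<inter> ?S t' = {}"
      by (auto simp: root_triples_def)
  qed simp
  finally show ?thesis .
qed

text \<open>Double counting of pairs (t, x): for x nonzero the equation is linear in
  \<open>t\<close> with one solution, and x = 0 is never a root because \<open>n\<close> is
  nonzero.\<close>

lemma sum_card_cubic_roots:
  fixes s n :: "'a::{field,finite}"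
  assumes "n \<noteq> 0"
  shows "(\<Sum>t\<in>UNIV. card {x. x ^ 3 - s * x\<^sup>2 + t * x - n = 0}) = CARD('a) - 1"
proof -
  let ?A = "\<lambda>t. {x. x ^ 3 - s * x\<^sup>2 + t * x - n = 0}"
  let ?t = "\<lambda>x. (n - x ^ 3 + s * x\<^sup>2) / x"
  have iff: "x \<in> ?A t \<longleftrightarrow> x \<noteq> 0 \<and> t = ?t x" for x t
  proof (cases "x = 0")
    case False
    have "x ^ 3 - s * x\<^sup>2 + t * x - n = 0 \<longleftrightarrow> t * x = n - x ^ 3 + s * x\<^sup>2"
      by (auto simp: algebra_simps)
    then show ?thesis
      using False by (simp add: eq_divide_eq)
  qed (use assms in \<open>simp add: zero_power\<close>)
  have "(\<Sum>t\<in>UNIV. card (?A t)) = card (SIGMA t:UNIV. ?A t)"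
    by (simp add: card_SigmaI)
  also have "(SIGMA t:UNIV. ?A t) = (\<lambda>x. (?t x, x)) ` (UNIV - {0})"
    using iff by auto
  also have "card \<dots> = CARD('a) - 1"
    by (subst card_image) (auto simp: inj_on_def card_Diff_singleton)
  finally show ?thesis .
qed

section \<open>Projective points and the Weierstrass curve\<close>

lemma proj_class_eq_iff:
  fixes sc :: "'k::field \<Rightarrow> 'v \<Rightarrow> 'v::zero"
  assumes "\<And>c d v. sc c (sc d v) = sc (c * d) v" "\<And>v. sc 1 v = v"
  shows "{sc c v |c. c \<noteq> 0} = {sc c w |c. c \<noteq> 0} \<longleftrightarrow> (\<exists>c. c \<noteq> 0 \<and> w = sc c v)"
proof
  assume "{sc c v |c. c \<noteq> 0} = {sc c w |c. c \<noteq> 0}"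
  moreover have "w \<in> {sc c w |c. c \<noteq> 0}"
    using assms(2)[of w] by (metis (mono_tags, lifting) mem_Collect_eq zero_neq_one)
  ultimately have "w \<in> {sc c v |c. c \<noteq> 0}" by simp
  then show "\<exists>c. c \<noteq> 0 \<and> w = sc c v" by blast
next
  assume "\<exists>c. c \<noteq> 0 \<and> w = sc c v"
  then obtain d where d: "d \<noteq> 0" "w = sc d v" by blast
  have "\<exists>c'. sc c v = sc c' w \<and> c' \<noteq> 0" if "c \<noteq> 0" for c
    by (rule exI[of _ "c / d"]) (use d that in \<open>simp add: assms(1)\<close>)
  moreover have "\<exists>c'. sc c w = sc c' v \<and> c' \<noteq> 0" if "c \<noteq> 0" for c
    by (rule exI[of _ "c * d"]) (use d that in \<open>simp add: assms(1)\<close>)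
  ultimately show "{sc c v |c. c \<noteq> 0} = {sc c w |c. c \<noteq> 0}"
    by blast
qed

text \<open>At W = 0 the equation becomes 4 U^3 = 0, so in characteristic different from 2 the only
  point at infinity is (0 : 1 : 0). The other points normalize to W = 1 and are fibred over U =
  t.\<close>

lemma card_weierstrass_points:
  fixes s n :: "'a::{field,finite}"
  assumes two: "(2::'a) \<noteq> 0"
  shows "card (weierstrass_points s n) = 1 + (\<Sum>t\<in>UNIV. card {V. V\<^sup>2 = cubic_disc s n t})"
proof -
  let ?P = "\<lambda>v::'a^3. (v$2)^2 * v$3 = s^2 * (v$1)^2 * v$3 - 4 * (v$1)^3 - 4 * s^3 * n * (v$3)^3
       - 27 * n^2 * (v$3)^3 + 18 * s * v$1 * n * (v$3)^2"
  let ?cl = "\<lambda>v::'a^3. {c *s v |c. c \<noteq> 0}"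
  let ?E = "SIGMA t:UNIV. {V. V\<^sup>2 = cubic_disc s n t}"
  let ?v = "\<lambda>(t, V). vector [t, V, 1] :: 'a^3"
  let ?o = "vector [0, 1, 0] :: 'a^3"
  have cl: "?cl v = ?cl w \<longleftrightarrow> (\<exists>c. c \<noteq> 0 \<and> w = c *s v)" for v w
    by (rule proj_class_eq_iff) (auto simp: vector_smult_assoc)
  have vec: "v = w \<longleftrightarrow> v$1 = w$1 \<and> v$2 = w$2 \<and> v$3 = w$3" for v w :: "'a^3"
    by (simp add: vec_eq_iff forall_3)
  have four: "(4::'a) \<noteq> 0"
    using two by (metis mult_eq_0_iff numeral_Bit0 mult_2)
  have inf: "?cl v = ?cl ?o" if "v \<noteq> 0" "?P v" "v$3 = 0" for v :: "'a^3"
  proof -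
    have "v$1 = 0" using that four by simp
    moreover from this have "v$2 \<noteq> 0" using that by (auto simp: vec)
    ultimately have "v = (v$2) *s ?o" using that by (simp add: vec)
    then have "?cl ?o = ?cl v" unfolding cl using \<open>v$2 \<noteq> 0\<close> by blast
    then show ?thesis ..
  qed
  have aff: "\<exists>x\<in>?E. ?cl v = ?cl (?v x)" if "?P v" "v$3 \<noteq> 0" for v :: "'a^3"
  proof -
    define t V where "t = v$1 / v$3" and "V = v$2 / v$3"
    have v: "v = (v$3) *s vector [t, V, 1]" using that by (simp add: vec t_def V_def)
    have eq: "v$1 = v$3 * t" "v$2 = v$3 * V" using that by (simp_all add: t_def V_def)
    have "(v$3) ^ 3 * V\<^sup>2 = (v$3) ^ 3 * cubic_disc s n t"
      using that(1) unfolding eq cubic_disc_def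
      by (simp add: power2_eq_square power3_eq_cube algebra_simps)
    then have "(t, V) \<in> ?E" using that by simp
    moreover have "?cl (vector [t, V, 1]) = ?cl v" unfolding cl using v that(2) by blast
    ultimately show ?thesis by (intro bexI[of _ "(t, V)"]) simp_all
  qed
  have "weierstrass_points s n = insert (?cl ?o) ((\<lambda>x. ?cl (?v x)) ` ?E)"
  proof (rule equalityI)
    show "weierstrass_points s n \<subseteq> insert (?cl ?o) ((\<lambda>x. ?cl (?v x)) ` ?E)"
    proof
      fix L assume "L \<in> weierstrass_points s n"
      then obtain v where v: "L = ?cl v" "v \<noteq> 0" "?P v"
        by (auto simp: weierstrass_points_def proj_points_def)
      show "L \<in> insert (?cl ?o) ((\<lambda>x. ?cl (?v x)) ` ?E)"
      proof (cases "v$3 = 0")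
        case True
        then show ?thesis using inf[OF v(2,3)] v(1) by simp
      next
        case False
        then show ?thesis using aff[OF v(3)] v(1) by blast
      qed
    qed
    have "?cl ?o \<in> weierstrass_points s n"
      unfolding weierstrass_points_def proj_points_def
      by (rule CollectI, rule exI[of _ ?o]) (auto simp: vec)
    moreover have "?cl (?v x) \<in> weierstrass_points s n" if "x \<in> ?E" for x
      unfolding weierstrass_points_def proj_points_def
      by (rule CollectI, rule exI[of _ "?v x"]) (use that in \<open>auto simp: vec cubic_disc_def\<close>)
    ultimately show "insert (?cl ?o) ((\<lambda>x. ?cl (?v x)) ` ?E) \<subseteq> weierstrass_points s n"
      by blast
  qed
  moreover have "?cl ?o \<notin> (\<lambda>x. ?cl (?v x)) ` ?E"
  proof
    assume "?cl ?o \<in> (\<lambda>x. ?cl (?v x)) ` ?E"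
    then obtain x where "?cl ?o = ?cl (?v x)" by blast
    then show False unfolding cl by (auto simp: vec split: prod.splits)
  qed
  moreover have "inj_on (\<lambda>x. ?cl (?v x)) ?E"
  proof (rule inj_onI)
    fix x y assume "?cl (?v x) = ?cl (?v y)"
    then show "x = y" unfolding cl by (auto simp: vec split: prod.splits)
  qed
  ultimately have "card (weierstrass_points s n) = 1 + card ?E"
    by (simp add: card_image)
  then show ?thesis by (simp add: card_SigmaI)
qed

text \<open>Let T1, T2, T3 be the three counts. Summing \<open>root_counts\<close> over
  \<open>t\<close>, with roots totalling q - 1 and discriminant square roots totalling E - 1, gives
  T2 + E - 1 = 2q, T3 = T1 + 3 and T1 + 2 T3 = 3(E - 1). This system determines all three.\<close>

lemma card_frob_triples:
  fixes s n :: "'a::{field,finite}"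
  assumes "s ^ 3 \<noteq> 27 * n" "(2::'a) \<noteq> 0" "n \<noteq> 0"
  defines "E \<equiv> int (card (weierstrass_points s n))"
  shows "int (card {(u, v, w) \<in> trace_norm_triples s n.
        u ^ CARD('a) = u \<and> v ^ CARD('a) = v \<and> w ^ CARD('a) = w}) = E - 3"
    and "int (card {(u, v, w) \<in> trace_norm_triples s n.
        u ^ CARD('a) = u \<and> v ^ CARD('a) = w \<and> w ^ CARD('a) = v}) = 2 * int CARD('a) + 1 - E"
    and "int (card {(u, v, w) \<in> trace_norm_triples s n.
        u ^ CARD('a) = v \<and> v ^ CARD('a) = w \<and> w ^ CARD('a) = u}) = E"
proof -
  define R where "R = (\<lambda>t. root_triples (to_ac s) (to_ac t) (to_ac n))"
  define t1 t2 t3 where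
    "t1 = (\<lambda>t. card {(u, v, w) \<in> R t. u ^ CARD('a) = u \<and> v ^ CARD('a) = v \<and> w ^ CARD('a) = w})"
    and "t2 = (\<lambda>t. card {(u, v, w) \<in> R t. u ^ CARD('a) = u \<and> v ^ CARD('a) = w \<and> w ^ CARD('a) = v})"
    and "t3 = (\<lambda>t. card {(u, v, w) \<in> R t. u ^ CARD('a) = v \<and> v ^ CARD('a) = w \<and> w ^ CARD('a) = u})"
  define e r where "e = (\<lambda>t. card {V. V\<^sup>2 = cubic_disc s n t})"
    and "r = (\<lambda>t. card {x. x ^ 3 - s * x\<^sup>2 + t * x - n = 0})"
  note counts = root_counts[OF assms(1,2)]
  have "t2 t + e t = 2" "t3 t + 3 * r t = t1 t + 3" "t1 t + 2 * t3 t = 3 * e t" for t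
    using counts[of t] by (auto simp: t1_def t2_def t3_def e_def r_def R_def)
  then have "(\<Sum>t\<in>UNIV. t2 t + e t) = (\<Sum>t\<in>(UNIV::'a set). 2)"
    "(\<Sum>t\<in>UNIV. t3 t + 3 * r t) = (\<Sum>t\<in>UNIV. t1 t + 3)"
    "(\<Sum>t\<in>UNIV. t1 t + 2 * t3 t) = (\<Sum>t\<in>UNIV. 3 * e t)"
    by simp_all
  then have sums: "sum t2 UNIV + sum e UNIV = 2 * CARD('a)"
    "sum t3 UNIV + 3 * sum r UNIV = sum t1 UNIV + 3 * CARD('a)"
    "sum t1 UNIV + 2 * sum t3 UNIV = 3 * sum e UNIV"
    by (simp_all add: sum.distrib sum_distrib_left)
  have r: "sum r UNIV = CARD('a) - 1"
    unfolding r_def by (rule sum_card_cubic_roots[OF assms(3)])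
  have E: "E = 1 + int (sum e UNIV)"
    unfolding E_def e_def using card_weierstrass_points[OF assms(2)] by simp
  have T: "card {(u, v, w) \<in> trace_norm_triples s n.
        u ^ CARD('a) = u \<and> v ^ CARD('a) = v \<and> w ^ CARD('a) = w} = sum t1 UNIV"
    "card {(u, v, w) \<in> trace_norm_triples s n.
        u ^ CARD('a) = u \<and> v ^ CARD('a) = w \<and> w ^ CARD('a) = v} = sum t2 UNIV"
    "card {(u, v, w) \<in> trace_norm_triples s n.
        u ^ CARD('a) = v \<and> v ^ CARD('a) = w \<and> w ^ CARD('a) = u} = sum t3 UNIV"
    unfolding t1_def t2_def t3_def R_def
    \<comment> \<open>Each condition makes Frobenius permute the entries of the triple, so it fixes
      their symmetric functions.\<close>
    by (rule card_trace_norm_triples; auto simp: frob_add power_mult_distrib algebra_simps)+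
  \<comment> \<open>This makes the natural-number difference \<open>CARD('a) - 1\<close> in
    \<open>r\<close> a true difference.\<close>
  have "CARD('a) \<ge> 2" by (rule card_field_ge_2)
  then show "int (card {(u, v, w) \<in> trace_norm_triples s n.
        u ^ CARD('a) = u \<and> v ^ CARD('a) = v \<and> w ^ CARD('a) = w}) = E - 3"
    "int (card {(u, v, w) \<in> trace_norm_triples s n.
        u ^ CARD('a) = u \<and> v ^ CARD('a) = w \<and> w ^ CARD('a) = v}) = 2 * int CARD('a) + 1 - E"
    "int (card {(u, v, w) \<in> trace_norm_triples s n.
        u ^ CARD('a) = v \<and> v ^ CARD('a) = w \<and> w ^ CARD('a) = u}) = E"
    unfolding T E using sums r by linarith+
qed

section \<open>Cubic algebras and their geometric embeddings\<close>

locale cubic_algebra =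
  fixes \<iota> :: "'a::field \<Rightarrow> 'b::comm_ring_1"
  assumes hom: "unital_hom \<iota>" and ex_basis: "\<exists>b. is_basis3 \<iota> b"
begin

abbreviation "bs \<equiv> basis3 \<iota>"

definition elem :: "'a^3 \<Rightarrow> 'b" where
  "elem c = (\<Sum>i\<in>UNIV. \<iota> (c$i) * bs i)"

lemma iota_simps [simp]: "\<iota> 1 = 1" "\<iota> (x + y) = \<iota> x + \<iota> y" "\<iota> (x * y) = \<iota> x * \<iota> y" "\<iota> 0 = 0"
proof -
  show "\<iota> 1 = 1" "\<iota> (x + y) = \<iota> x + \<iota> y" "\<iota> (x * y) = \<iota> x * \<iota> y" for x y
    using hom by (auto simp: unital_hom_def)
  from this(2)[of 0 0] show "\<iota> 0 = 0" by simp
qed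

lemma ex1_coords: "\<exists>!c. x = elem c"
proof -
  have "is_basis3 \<iota> bs"
    using ex_basis unfolding basis3_def by (rule someI_ex)
  then show ?thesis by (simp add: is_basis3_def elem_def)
qed

lemma elem_coords [simp]: "elem (coords \<iota> x) = x"
  using theI'[OF ex1_coords[of x]] unfolding coords_def elem_def by simp

lemma coords_elem [simp]: "coords \<iota> (elem c) = c"
  using ex1_coords[of "elem c"] elem_coords[of "elem c"] by metis

lemma elem_eq_iff: "elem c = elem d \<longleftrightarrow> c = d"
  by (metis coords_elem)

lemma elem_add: "elem (c + d) = elem c + elem d"
  by (simp add: elem_def sum.distrib algebra_simps)

lemma elem_scale: "elem (a *s c) = \<iota> a * elem c"
  by (simp add: elem_def sum_distrib_left algebra_simps)

lemma elem_0 [simp]: "elem 0 = 0"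
  by (simp add: elem_def)

lemma elem_eq_0_iff [simp]: "elem c = 0 \<longleftrightarrow> c = 0"
  using elem_eq_iff[of c 0] by simp

lemma coords_add: "coords \<iota> (x + y) = coords \<iota> x + coords \<iota> y"
  by (metis coords_elem elem_add elem_coords)

lemma coords_scale: "coords \<iota> (\<iota> a * x) = a *s coords \<iota> x"
  by (metis coords_elem elem_coords elem_scale)

lemma coords_0 [simp]: "coords \<iota> 0 = 0"
  by (metis coords_elem elem_0)

lemma coords_sum: "coords \<iota> (\<Sum>i\<in>A. f i) = (\<Sum>i\<in>A. coords \<iota> (f i))"
  by (induction A rule: infinite_finite_induct) (auto simp: coords_add)

lemma elem_axis [simp]: "elem (axis k 1) = bs k"
proof -
  have "elem (axis k 1) = (\<Sum>i\<in>UNIV. if i = k then bs i else 0)"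
    unfolding elem_def by (rule sum.cong) (auto simp: axis_def)
  then show ?thesis by simp
qed

lemma coords_basis [simp]: "coords \<iota> (bs k) = axis k 1"
  by (metis coords_elem elem_axis)

lemma coords_mult: "coords \<iota> (x * y) = mult_matrix \<iota> x *v coords \<iota> y"
proof -
  have "x * y = (\<Sum>j\<in>UNIV. \<iota> (coords \<iota> y $ j) * (x * bs j))"
    by (subst elem_coords[of y, symmetric]) (simp add: elem_def sum_distrib_left algebra_simps)
  then have "coords \<iota> (x * y) = (\<Sum>j\<in>UNIV. (coords \<iota> y $ j) *s coords \<iota> (x * bs j))"
    by (simp add: coords_sum coords_scale)
  then show ?thesis
    by (simp add: vec_eq_iff matrix_vector_mult_def mult_matrix_def mult.commute)
qed

text \<open>Base change along \<open>id\<close> returns B itself. Hence the forms defining the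
  curve, evaluated over F, are the trace and norm of B.\<close>

lemma mult_matrix_eq_bc: "mult_matrix \<iota> x = bc_matrix \<iota> id (coords \<iota> x)"
proof -
  have "coords \<iota> (x * y) = (\<Sum>k\<in>UNIV. (coords \<iota> x $ k) *s coords \<iota> (bs k * y))" for y
  proof -
    have "x * y = (\<Sum>k\<in>UNIV. \<iota> (coords \<iota> x $ k) * (bs k * y))"
      by (subst elem_coords[of x, symmetric]) (simp add: elem_def sum_distrib_left sum_distrib_right mult_ac)
    then show ?thesis by (simp add: coords_sum coords_scale)
  qed
  then show ?thesis
    by (simp add: vec_eq_iff mult_matrix_def bc_matrix_def)
qed

lemma alg_trace_elem: "alg_trace \<iota> (elem c) = trace (bc_matrix \<iota> id c)"
  by (simp add: alg_trace_def mult_matrix_eq_bc)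

lemma alg_norm_elem: "alg_norm \<iota> (elem c) = det (bc_matrix \<iota> id c)"
  by (simp add: alg_norm_def mult_matrix_eq_bc)

text \<open>The map from x to 1 \<otimes> x, from B into its base change to the closure.\<close>

definition lift :: "'b \<Rightarrow> ('a alg_closure)^3" where
  "lift x = (\<chi> i. to_ac (coords \<iota> x $ i))"

lemma bc_matrix_lift: "bc_matrix \<iota> to_ac (lift x) $ i $ j = to_ac (mult_matrix \<iota> x $ i $ j)"
  by (subst mult_matrix_eq_bc[of x]) (simp add: bc_matrix_def lift_def to_ac_sum)

lemma lift_mult: "lift (x * y) = bc_matrix \<iota> to_ac (lift x) *v lift y"
  by (simp add: vec_eq_iff matrix_vector_mult_def bc_matrix_lift)
    (simp add: lift_def coords_mult matrix_vector_mult_def to_ac_sum)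

lemma lift_add: "lift (x + y) = lift x + lift y"
  by (simp add: vec_eq_iff lift_def coords_add)

lemma lift_scale: "lift (\<iota> a * x) = to_ac a *s lift x"
  by (simp add: vec_eq_iff lift_def coords_scale)

lemma lift_basis: "lift (bs k) = axis k 1"
  by (simp add: vec_eq_iff lift_def axis_def)

lemma lift_eq_iff: "lift x = lift y \<longleftrightarrow> x = y"
proof
  assume "lift x = lift y"
  then have "coords \<iota> x = coords \<iota> y" by (simp add: lift_def vec_eq_iff)
  then show "x = y" by (metis elem_coords)
qed simp

lemma trace_lift: "trace (bc_matrix \<iota> to_ac (lift x)) = to_ac (alg_trace \<iota> x)"
  by (simp add: trace_def alg_trace_def bc_matrix_lift to_ac_sum)

lemma det_lift: "det (bc_matrix \<iota> to_ac (lift x)) = to_ac (alg_norm \<iota> x)"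
  by (simp add: det_3 alg_norm_def bc_matrix_lift)

end

section \<open>Splitting of the base change as K^3\<close>

locale split_cubic_algebra = cubic_algebra \<iota> for \<iota> :: "'a::field \<Rightarrow> 'b::comm_ring_1" +
  fixes \<phi> :: "('a alg_closure)^3 \<Rightarrow> ('a alg_closure)^3"
  assumes bij_phi: "bij \<phi>" and linear_phi: "Vector_Spaces.linear (*s) (*s) \<phi>"
    and phi_one: "\<phi> (lift 1) = 1"
    and phi_mult: "\<phi> (bc_matrix \<iota> to_ac x *v y) = \<phi> x * \<phi> y"
begin

lemma phi_add: "\<phi> (x + y) = \<phi> x + \<phi> y" and phi_scale: "\<phi> (c *s x) = c *s \<phi> x"
  using linear_phi by (simp_all add: Vector_Spaces.linear_iff)

lemma phi_eq_iff: "\<phi> x = \<phi> y \<longleftrightarrow> x = y"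
  using bij_phi by (auto simp: bij_def inj_def)

lemma phi_0 [simp]: "\<phi> 0 = 0"
  using phi_scale[of 0 0] by simp

lemma phi_inv [simp]: "\<phi> (inv_into UNIV \<phi> y) = y"
  using bij_phi by (simp add: bij_is_surj surj_f_inv_f)

text \<open>The isomorphism \<open>\<phi>\<close> conjugates multiplication by \<open>x\<close> into
  the diagonal matrix with entries \<open>\<phi> x\<close>, and conjugation preserves trace and
  determinant.\<close>

lemma phi_trace_det:
  "trace (bc_matrix \<iota> to_ac x) = \<phi> x $ 1 + \<phi> x $ 2 + \<phi> x $ 3"
  "det (bc_matrix \<iota> to_ac x) = \<phi> x $ 1 * \<phi> x $ 2 * \<phi> x $ 3"
proof -
  define P where "P = matrix \<phi>"
  define D where "D = (\<chi> i j. if i = j then \<phi> x $ i else 0)"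
  have P: "P *v y = \<phi> y" for y
    unfolding P_def by (rule matrix_works[OF linear_phi])
  have D: "D *v y = \<phi> x * y" for y
    by (simp add: vec_eq_iff D_def matrix_vector_mult_def if_distrib[where f = "\<lambda>a. a * _"]
        cong: if_cong)
  have eq: "P ** bc_matrix \<iota> to_ac x = D ** P"
    by (simp add: matrix_eq P D phi_mult flip: matrix_vector_mul_assoc)
  have "inj ((*v) P)"
    using phi_eq_iff by (simp add: inj_def P)
  then obtain Q where Q: "Q ** P = mat 1"
    using matrix_left_invertible_injective[of P] by blast
  then have Q': "P ** Q = mat 1"
    by (simp add: matrix_left_right_inverse)
  have bc: "bc_matrix \<iota> to_ac x = Q ** (D ** P)"
    using arg_cong[OF eq, of "\<lambda>A. Q ** A"] by (simp add: matrix_mul_assoc Q)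
  have "trace (bc_matrix \<iota> to_ac x) = trace ((D ** P) ** Q)"
    unfolding bc by (rule trace_mul_sym)
  also have "(D ** P) ** Q = D"
    by (simp add: Q' flip: matrix_mul_assoc)
  finally show "trace (bc_matrix \<iota> to_ac x) = \<phi> x $ 1 + \<phi> x $ 2 + \<phi> x $ 3"
    by (simp add: trace_def sum_3 D_def)
  have "det Q * det P = 1"
    using arg_cong[OF Q, of det] by (simp add: det_mul)
  then have "det (bc_matrix \<iota> to_ac x) = det D"
    by (simp add: bc det_mul mult.left_commute)
  also have "\<dots> = \<phi> x $ 1 * \<phi> x $ 2 * \<phi> x $ 3"
    by (simp add: det_3 D_def)
  finally show "det (bc_matrix \<iota> to_ac x) = \<phi> x $ 1 * \<phi> x $ 2 * \<phi> x $ 3" .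
qed

text \<open>The coordinate projections of K^3 restricted to B; they turn out to be exactly the
  geometric embeddings.\<close>

definition sig :: "3 \<Rightarrow> 'b \<Rightarrow> 'a alg_closure" where
  "sig i x = \<phi> (lift x) $ i"

lemma alg_trace_sig: "to_ac (alg_trace \<iota> x) = sig 1 x + sig 2 x + sig 3 x"
  and alg_norm_sig: "to_ac (alg_norm \<iota> x) = sig 1 x * sig 2 x * sig 3 x"
  using phi_trace_det[of "lift x"] by (simp_all add: trace_lift det_lift sig_def)

lemma sig_hom: "algebra_hom \<iota> to_ac (sig i)"
proof -
  have "sig i (\<iota> a) = to_ac a" for a
    using lift_scale[of a 1] by (simp add: sig_def phi_scale phi_one)
  then show ?thesis
    by (simp add: algebra_hom_def unital_hom_def sig_def phi_one lift_add lift_mult phi_add phi_mult)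
qed

lemma sig_eqD: "(\<And>i. sig i x = sig i y) \<Longrightarrow> x = y"
  using phi_eq_iff[of "lift x" "lift y"] by (simp add: sig_def vec_eq_iff lift_eq_iff[unfolded vec_eq_iff])

lemma phi_expand: "\<phi> w $ i = (\<Sum>k\<in>UNIV. w$k * sig i (bs k))"
proof -
  have "\<phi> w = (\<Sum>k\<in>UNIV. (w$k) *s \<phi> (axis k 1))"
    using matrix_works[OF linear_phi, of w]
    by (simp add: matrix_mult_sum column_def matrix_def)
  then show ?thesis
    by (simp add: sig_def lift_basis)
qed

text \<open>The images of B span K^3 over K, so projections agreeing on B agree everywhere; a
  standard basis vector tells two different projections apart.\<close>

lemma inj_sig: "inj sig"
proof (rule injI)
  fix i j assume "sig i = sig j"
  then have "\<phi> w $ i = \<phi> w $ j" for w by (simp add: phi_expand)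
  from this[of "inv_into UNIV \<phi> (axis i 1)"] show "i = j"
    by (simp add: axis_def split: if_splits)
qed

text \<open>
  A geometric embedding extends linearly to a character of \<open>K \<otimes> B = K^3\<close>. It is nonzero on some
  primitive idempotent \<open>e\<close>, and \<open>w e = w_i e\<close> then shows that it is the \<open>i\<close>-th projection.
\<close>

lemma geom_embeddings_eq: "geom_embeddings \<iota> = range sig"
proof (rule equalityI)
  show "range sig \<subseteq> geom_embeddings \<iota>"
    using sig_hom by (auto simp: geom_embeddings_def)
  show "geom_embeddings \<iota> \<subseteq> range sig"
  proof
    fix \<sigma> assume "\<sigma> \<in> geom_embeddings \<iota>"
    then have \<sigma>: "\<sigma> 1 = 1" "\<sigma> (x + y) = \<sigma> x + \<sigma> y" "\<sigma> (x * y) = \<sigma> x * \<sigma> y" "\<sigma> (\<iota> a) = to_ac a" for x y a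
      by (auto simp: geom_embeddings_def algebra_hom_def unital_hom_def)
    have [simp]: "\<sigma> 0 = 0" using \<sigma>(2)[of 0 0] by (metis add.right_neutral add_cancel_right_right)
    have \<sigma>_sum: "\<sigma> (\<Sum>i\<in>A. f i) = (\<Sum>i\<in>A. \<sigma> (f i))" for f :: "3 \<Rightarrow> 'b" and A
      by (induction A rule: infinite_finite_induct) (auto simp: \<sigma>)
    define \<psi> where "\<psi> w = (\<Sum>k\<in>UNIV. w$k * \<sigma> (bs k))" for w :: "('a alg_closure)^3"
    have \<sigma>_elem: "\<sigma> (elem c) = (\<Sum>k\<in>UNIV. to_ac (c$k) * \<sigma> (bs k))" for c
      by (simp add: elem_def \<sigma>_sum \<sigma>)
    have \<psi>_lift: "\<psi> (lift x) = \<sigma> x" for x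
      using \<sigma>_elem[of "coords \<iota> x"] by (simp add: \<psi>_def lift_def)
    have \<psi>_mult: "\<psi> (bc_matrix \<iota> to_ac w *v y) = \<psi> w * \<psi> y" for w y
    proof -
      \<comment> \<open>This is \<open>\<sigma>\<close> applied to the multiplication table of the
        basis; multiplicativity of \<open>\<psi>\<close> follows by bilinear expansion.\<close>
      have m: "(\<Sum>i\<in>UNIV. to_ac (mult_matrix \<iota> (bs k) $ i $ j) * \<sigma> (bs i)) = \<sigma> (bs k) * \<sigma> (bs j)" for j k
        using \<sigma>_elem[of "coords \<iota> (bs k * bs j)"] by (simp add: \<sigma> mult_matrix_def)
      have "\<psi> (bc_matrix \<iota> to_ac w *v y) = (\<Sum>i\<in>UNIV. \<Sum>j\<in>UNIV. \<Sum>k\<in>UNIV.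
          w$k * y$j * (to_ac (mult_matrix \<iota> (bs k) $ i $ j) * \<sigma> (bs i)))"
        by (simp add: \<psi>_def matrix_vector_mult_def bc_matrix_def sum_distrib_left sum_distrib_right mult_ac)
      also have "\<dots> = (\<Sum>j\<in>UNIV. \<Sum>k\<in>UNIV. \<Sum>i\<in>UNIV.
          w$k * y$j * (to_ac (mult_matrix \<iota> (bs k) $ i $ j) * \<sigma> (bs i)))"
        by (subst sum.swap) (rule sum.cong[OF refl], rule sum.swap)
      also have "\<dots> = (\<Sum>j\<in>UNIV. \<Sum>k\<in>UNIV. w$k * y$j * (\<sigma> (bs k) * \<sigma> (bs j)))"
        by (simp only: m flip: sum_distrib_left)
      also have "\<dots> = \<psi> w * \<psi> y"
        unfolding \<psi>_def sum_product by (subst sum.swap) (simp add: mult_ac)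
      finally show ?thesis .
    qed
    have \<psi>_add: "\<psi> (v + w) = \<psi> v + \<psi> w" and \<psi>_scale: "\<psi> (c *s w) = c * \<psi> w" for c v w
      by (simp_all add: \<psi>_def sum.distrib sum_distrib_left algebra_simps)
    define \<epsilon> where "\<epsilon> i = inv_into UNIV \<phi> (axis i 1)" for i
    have "\<phi> (lift 1) = \<phi> (\<epsilon> 1 + \<epsilon> 2 + \<epsilon> 3)"
      by (simp add: phi_one phi_add \<epsilon>_def vec_eq_iff forall_3 axis_def)
    then have "lift 1 = \<epsilon> 1 + \<epsilon> 2 + \<epsilon> 3" by (simp only: phi_eq_iff)
    then have "\<psi> (\<epsilon> 1) + \<psi> (\<epsilon> 2) + \<psi> (\<epsilon> 3) = 1"
      using \<psi>_lift[of 1] by (simp add: \<psi>_add \<sigma>)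
    then obtain i where i: "\<psi> (\<epsilon> i) \<noteq> 0"
      by (metis add.right_neutral zero_neq_one)
    have "\<psi> w = \<phi> w $ i" for w
    proof -
      have "\<phi> (bc_matrix \<iota> to_ac w *v \<epsilon> i) = \<phi> ((\<phi> w $ i) *s \<epsilon> i)"
        by (simp add: phi_mult phi_scale \<epsilon>_def vec_eq_iff axis_def)
      then have "bc_matrix \<iota> to_ac w *v \<epsilon> i = (\<phi> w $ i) *s \<epsilon> i" by (simp only: phi_eq_iff)
      then have "\<psi> w * \<psi> (\<epsilon> i) = \<phi> w $ i * \<psi> (\<epsilon> i)"
        by (metis \<psi>_mult \<psi>_scale)
      with i show ?thesis by simp
    qed
    then have "\<sigma> x = sig i x" for x
      using \<psi>_lift[of x] by (simp add: sig_def)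
    then show "\<sigma> \<in> range sig" by auto
  qed
qed

end

lemma etale_cubic_obtain:
  fixes \<iota> :: "'a::field \<Rightarrow> 'b::comm_ring_1"
  assumes "etale_cubic \<iota>"
  obtains \<phi> where "split_cubic_algebra \<iota> \<phi>"
proof -
  from assms have c: "cubic_algebra \<iota>"
    by (simp add: etale_cubic_def cubic_algebra_def)
  interpret cubic_algebra \<iota> by (rule c)
  from assms have "\<exists>\<phi> :: ('a alg_closure)^3 \<Rightarrow> ('a alg_closure)^3.
     bij \<phi> \<and> Vector_Spaces.linear (*s) (*s) \<phi> \<and> \<phi> (lift 1) = 1 \<and>
     (\<forall>x y. \<phi> (bc_matrix \<iota> to_ac x *v y) = \<phi> x * \<phi> y)"
    unfolding etale_cubic_def lift_def by (elim conjE)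
  then obtain \<phi> :: "('a alg_closure)^3 \<Rightarrow> ('a alg_closure)^3" where
    "bij \<phi> \<and> Vector_Spaces.linear (*s) (*s) \<phi> \<and> \<phi> (lift 1) = 1 \<and>
     (\<forall>x y. \<phi> (bc_matrix \<iota> to_ac x *v y) = \<phi> x * \<phi> y)" ..
  then have "split_cubic_algebra \<iota> \<phi>"
    by (simp add: split_cubic_algebra_def split_cubic_algebra_axioms_def c)
  then show thesis by (rule that)
qed

section \<open>Frobenius on the embeddings and Galois descent\<close>

locale finite_split_cubic_algebra = split_cubic_algebra \<iota> \<phi>
  for \<iota> :: "'a::{field,finite} \<Rightarrow> 'b::comm_ring_1" and \<phi>
begin

text \<open>Frobenius fixes F, so composing it with an embedding gives an F-algebra homomorphism to
  the closure again, hence one of the three.\<close>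

lemma frob_sig: "\<exists>j. \<forall>x. sig i x ^ CARD('a) = sig j x"
proof -
  have "algebra_hom \<iota> to_ac (\<lambda>x. sig i x ^ CARD('a))"
    using sig_hom[of i]
    by (simp add: algebra_hom_def unital_hom_def frob_add power_mult_distrib frob_to_ac)
  then have "(\<lambda>x. sig i x ^ CARD('a)) \<in> range sig"
    by (simp add: geom_embeddings_eq[symmetric] geom_embeddings_def)
  then show ?thesis by (auto simp: fun_eq_iff)
qed

definition tau :: "3 \<Rightarrow> 3" where
  "tau i = (SOME j. \<forall>x. sig i x ^ CARD('a) = sig j x)"

lemma sig_tau: "sig i x ^ CARD('a) = sig (tau i) x"
  using someI_ex[OF frob_sig[of i]] unfolding tau_def by blast

lemma inj_tau: "inj tau"
proof (rule injI)
  fix i j assume "tau i = tau j"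
  then have "sig i x ^ CARD('a) = sig j x ^ CARD('a)" for x by (simp add: sig_tau)
  then have "sig i = sig j" by (simp add: frob_eq_iff fun_eq_iff)
  then show "i = j" using inj_sig by (simp add: inj_def)
qed

text \<open>Galois descent: a Frobenius-compatible vector has Frobenius-fixed coordinates.\<close>

lemma sig_surj:
  assumes "\<And>i. y i ^ CARD('a) = y (tau i)"
  shows "\<exists>x. \<forall>i. sig i x = y i"
proof -
  define w where "w = inv_into UNIV \<phi> (\<chi> i. y i)"
  define w' where "w' = (\<chi> k. w$k ^ CARD('a))"
  have w: "\<phi> w $ i = y i" for i by (simp add: w_def)
  \<comment> \<open>Frobenius acts on the coordinates \<open>w$k\<close> and carries each
    \<open>sig i (bs k)\<close> to \<open>sig (tau i) (bs k)\<close>. Compatibility of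
    \<open>y\<close> therefore says that \<open>w\<close> and \<open>w'\<close> have the same
    image.\<close>
  have "\<phi> w' $ (tau i) = y (tau i)" for i
  proof -
    have "\<phi> w' $ (tau i) = (\<Sum>k\<in>UNIV. (w$k * sig i (bs k)) ^ CARD('a))"
      by (simp add: phi_expand w'_def power_mult_distrib sig_tau)
    also have "\<dots> = (\<phi> w $ i) ^ CARD('a)"
      by (simp add: phi_expand frob_sum)
    finally show ?thesis by (simp add: w assms)
  qed
  moreover have "surj tau"
    by (rule finite_UNIV_inj_surj) (use inj_tau in auto)
  ultimately have "\<phi> w' $ i = y i" for i
    using surjD[of tau i] by fastforce
  then have "\<phi> w' = \<phi> w" by (simp add: vec_eq_iff w)
  then have "w' = w" by (simp add: phi_eq_iff)
  then have "w$k ^ CARD('a) = w$k" for k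
    unfolding w'_def vec_eq_iff by simp
  then have "\<exists>c. \<forall>k. w$k = to_ac (c k)"
    by (intro choice allI) (auto simp: frob_fixed_iff)
  then obtain c where "\<And>k. w$k = to_ac (c k)" by blast
  then have "lift (elem (\<chi> k. c k)) = w" by (simp add: lift_def vec_eq_iff)
  then have "sig i (elem (\<chi> k. c k)) = y i" for i by (simp add: sig_def w)
  then show ?thesis by blast
qed

end

text \<open>Collects what the counting uses of the splitting, in terms of three named embeddings, so
  that \<open>\<phi>\<close> and the indices can be forgotten.\<close>

definition geom_labelling ::
    "('a::{field,finite} \<Rightarrow> 'b::comm_ring_1) \<Rightarrow> ('b \<Rightarrow> 'a alg_closure) \<Rightarrow> ('b \<Rightarrow> 'a alg_closure)
      \<Rightarrow> ('b \<Rightarrow> 'a alg_closure) \<Rightarrow> bool" where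
  "geom_labelling \<iota> a b c \<longleftrightarrow> geom_embeddings \<iota> = {a, b, c} \<and> a \<noteq> b \<and> b \<noteq> c \<and> a \<noteq> c \<and>
     (\<forall>x. to_ac (alg_trace \<iota> x) = a x + b x + c x) \<and>
     (\<forall>x. to_ac (alg_norm \<iota> x) = a x * b x * c x) \<and> inj (\<lambda>x. (a x, b x, c x))"

context finite_split_cubic_algebra
begin

lemma UNIV_3_eq:
  assumes "i \<noteq> j" "j \<noteq> k" "i \<noteq> k"
  shows "UNIV = {i, j, k :: 3}"
  by (rule sym, rule card_seteq) (use assms in auto)

lemma geom_labelling_sig:
  assumes "i \<noteq> j" "j \<noteq> k" "i \<noteq> k"
  shows "geom_labelling \<iota> (sig i) (sig j) (sig k)"
proof -
  note U = UNIV_3_eq[OF assms]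
  have "geom_embeddings \<iota> = {sig i, sig j, sig k}"
    unfolding geom_embeddings_eq U by simp
  moreover have "sig i \<noteq> sig j" "sig j \<noteq> sig k" "sig i \<noteq> sig k"
    using inj_sig assms by (auto simp: inj_def)
  moreover have "to_ac (alg_trace \<iota> x) = (\<Sum>l\<in>UNIV. sig l x)" for x
    by (simp add: alg_trace_sig sum_3)
  then have "to_ac (alg_trace \<iota> x) = sig i x + sig j x + sig k x" for x
    unfolding U using assms by (simp add: add.assoc)
  moreover have "to_ac (alg_norm \<iota> x) = (\<Prod>l\<in>UNIV. sig l x)" for x
    unfolding UNIV_3 by (simp add: alg_norm_sig mult.assoc)
  then have "to_ac (alg_norm \<iota> x) = sig i x * sig j x * sig k x" for x
    unfolding U using assms by (simp add: mult.assoc)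
  moreover have "inj (\<lambda>x. (sig i x, sig j x, sig k x))"
  proof (rule injI)
    fix x y assume "(sig i x, sig j x, sig k x) = (sig i y, sig j y, sig k y)"
    then have "\<forall>l\<in>{i, j, k}. sig l x = sig l y" by auto
    then show "x = y" unfolding U[symmetric] by (intro sig_eqD) auto
  qed
  ultimately show ?thesis by (simp add: geom_labelling_def)
qed

text \<open>Descent for a single labelled triple. The premise quantifies over \<open>y\<close> so
  that, once the values of \<open>tau\<close> are known, each \<open>y (tau i)\<close> rewrites to
  one of \<open>u\<close>, \<open>v\<close>, \<open>w\<close>.\<close>

lemma ex_sig_eq:
  assumes "i \<noteq> j" "j \<noteq> k" "i \<noteq> k"
    and "\<And>y. y i = u \<Longrightarrow> y j = v \<Longrightarrow> y k = w \<Longrightarrow>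
      u ^ CARD('a) = y (tau i) \<and> v ^ CARD('a) = y (tau j) \<and> w ^ CARD('a) = y (tau k)"
  shows "(u, v, w) \<in> range (\<lambda>x. (sig i x, sig j x, sig k x))"
proof -
  define y where "y l = (if l = i then u else if l = j then v else w)" for l
  have y: "y i = u" "y j = v" "y k = w" using assms by (auto simp: y_def)
  have "\<forall>l\<in>{i, j, k}. y l ^ CARD('a) = y (tau l)"
    using assms(4)[of y] y by auto
  then obtain x where "\<forall>l. sig l x = y l"
    using sig_surj[of y] unfolding UNIV_3_eq[OF assms(1-3), symmetric] by auto
  then show ?thesis using y by (intro image_eqI[of _ _ x]) auto
qed

end

text \<open>The three cycle types in S_3. In each, descent identifies B with all triples on which
  Frobenius acts by the given permutation; in \<open>swap\<close> the fixed embedding is put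
  first.\<close>

lemma etale_cubic_frob_cases:
  fixes \<iota> :: "'a::{field,finite} \<Rightarrow> 'b::comm_ring_1"
  assumes "etale_cubic \<iota>"
  obtains (split) a b c where "geom_labelling \<iota> a b c"
      "range (\<lambda>x. (a x, b x, c x)) = {(u, v, w). u ^ CARD('a) = u \<and> v ^ CARD('a) = v \<and> w ^ CARD('a) = w}"
    | (swap) a b c where "geom_labelling \<iota> a b c"
      "range (\<lambda>x. (a x, b x, c x)) = {(u, v, w). u ^ CARD('a) = u \<and> v ^ CARD('a) = w \<and> w ^ CARD('a) = v}"
    | (cycle) a b c where "geom_labelling \<iota> a b c"
      "range (\<lambda>x. (a x, b x, c x)) = {(u, v, w). u ^ CARD('a) = v \<and> v ^ CARD('a) = w \<and> w ^ CARD('a) = u}"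
proof -
  from etale_cubic_obtain[OF assms] obtain \<phi> where "split_cubic_algebra \<iota> \<phi>" .
  then interpret finite_split_cubic_algebra \<iota> \<phi> by (simp add: finite_split_cubic_algebra_def)
  have id: thesis if d: "i \<noteq> j" "j \<noteq> k" "i \<noteq> k" and t: "tau i = i" "tau j = j" "tau k = k" for i j k
    by (rule split[OF geom_labelling_sig[OF d]])
      (auto simp: sig_tau t intro!: ex_sig_eq[OF d])
  have sw: thesis if d: "i \<noteq> j" "j \<noteq> k" "i \<noteq> k" and t: "tau i = i" "tau j = k" "tau k = j" for i j k
    by (rule swap[OF geom_labelling_sig[OF d]])
      (auto simp: sig_tau t intro!: ex_sig_eq[OF d])
  have cy: thesis if d: "i \<noteq> j" "j \<noteq> k" "i \<noteq> k" and t: "tau i = j" "tau j = k" "tau k = i" for i j k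
    by (rule cycle[OF geom_labelling_sig[OF d]])
      (auto simp: sig_tau t intro!: ex_sig_eq[OF d])
  have ne: "(1::3) \<noteq> 2" "(2::3) \<noteq> 3" "(1::3) \<noteq> 3" "(2::3) \<noteq> 1" "(3::3) \<noteq> 2" "(3::3) \<noteq> 1"
    by simp_all
  have "tau 1 \<noteq> tau 2" "tau 2 \<noteq> tau 3" "tau 1 \<noteq> tau 3"
    by (simp_all add: inj_eq[OF inj_tau])
  with exhaust_3[of "tau 1"] exhaust_3[of "tau 2"] exhaust_3[of "tau 3"] consider
      "tau 1 = 1" "tau 2 = 2" "tau 3 = 3" | "tau 1 = 1" "tau 2 = 3" "tau 3 = 2"
    | "tau 1 = 2" "tau 2 = 1" "tau 3 = 3" | "tau 1 = 2" "tau 2 = 3" "tau 3 = 1"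
    | "tau 1 = 3" "tau 2 = 1" "tau 3 = 2" | "tau 1 = 3" "tau 2 = 2" "tau 3 = 1"
    by metis
  then show thesis
  proof cases
    case 1 with id[OF ne(1-3)] show thesis by blast
  next
    case 2 with sw[OF ne(1-3)] show thesis by blast
  next
    case 3 with sw[OF ne(6,1,5)] show thesis by blast
  next
    case 4 with cy[OF ne(1-3)] show thesis by blast
  next
    case 5 with cy[OF ne(3,5,1)] show thesis by blast
  next
    case 6 with sw[OF ne(4,3,2)] show thesis by blast
  qed
qed

section \<open>Rational points of the curve\<close>

locale labelled_cubic_algebra = cubic_algebra \<iota>
  for \<iota> :: "'a::{field,finite} \<Rightarrow> 'b::comm_ring_1" +
  fixes a b c :: "'b \<Rightarrow> 'a alg_closure"
  assumes labelling: "geom_labelling \<iota> a b c"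
begin

lemma embeddings: "geom_embeddings \<iota> = {a, b, c}"
  and distinct: "a \<noteq> b" "b \<noteq> c" "a \<noteq> c"
  and to_ac_trace: "to_ac (alg_trace \<iota> x) = a x + b x + c x"
  and to_ac_norm: "to_ac (alg_norm \<iota> x) = a x * b x * c x"
  using labelling by (auto simp: geom_labelling_def)

lemma embedding_simps:
  assumes "\<sigma> \<in> geom_embeddings \<iota>"
  shows "\<sigma> 1 = 1" "\<sigma> (x * y) = \<sigma> x * \<sigma> y" "\<sigma> (\<iota> r) = to_ac r" "\<sigma> 0 = 0"
proof -
  show "\<sigma> 1 = 1" "\<sigma> (x * y) = \<sigma> x * \<sigma> y" "\<sigma> (\<iota> r) = to_ac r" for r
    using assms by (auto simp: geom_embeddings_def algebra_hom_def unital_hom_def)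
  from this(3)[of 0] show "\<sigma> 0 = 0" by simp
qed

lemma abc_simps [simp]:
  "a 1 = 1" "a (x * y) = a x * a y" "a (\<iota> r) = to_ac r" "a 0 = 0"
  "b 1 = 1" "b (x * y) = b x * b y" "b (\<iota> r) = to_ac r" "b 0 = 0"
  "c 1 = 1" "c (x * y) = c x * c y" "c (\<iota> r) = to_ac r" "c 0 = 0"
  using embedding_simps[of a] embedding_simps[of b] embedding_simps[of c] by (simp_all add: embeddings)

lemma abc_eq_iff: "x = y \<longleftrightarrow> a x = a y \<and> b x = b y \<and> c x = c y"
  using labelling by (auto simp: geom_labelling_def inj_def)

lemma trace_eq_iff: "alg_trace \<iota> x = r \<longleftrightarrow> a x + b x + c x = to_ac r"
  by (metis to_ac_trace to_ac_eq_iff)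

lemma norm_eq_iff: "alg_norm \<iota> x = r \<longleftrightarrow> a x * b x * c x = to_ac r"
  by (metis to_ac_norm to_ac_eq_iff)

lemma trace_scale: "alg_trace \<iota> (\<iota> r * x) = r * alg_trace \<iota> x"
  by (simp add: trace_eq_iff to_ac_trace algebra_simps)

lemma norm_scale: "alg_norm \<iota> (\<iota> r * x) = r ^ 3 * alg_norm \<iota> x"
  by (simp add: norm_eq_iff to_ac_norm algebra_simps power3_eq_cube)

text \<open>A nonzero norm makes all three images nonzero. The triple of inverses satisfies
  \<open>P\<close> too, so it comes from an element of B, and the unit condition in
  \<open>N_B\<close> holds automatically.\<close>

lemma N_B_eq:
  assumes range: "range (\<lambda>x. (a x, b x, c x)) = {(u, v, w). P u v w}"
    and inverse: "\<And>u v w. P u v w \<Longrightarrow> P (inverse u) (inverse v) (inverse w)"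
    and n: "n \<noteq> 0"
  shows "{x. x dvd 1 \<and> alg_trace \<iota> x = s \<and> alg_norm \<iota> x = n} = {x. alg_trace \<iota> x = s \<and> alg_norm \<iota> x = n}"
    and "N_B \<iota> s n = card {(u, v, w) \<in> trace_norm_triples s n. P u v w}"
proof -
  have unit: "x dvd 1" if x: "alg_norm \<iota> x = n" for x
  proof -
    have nz: "a x \<noteq> 0" "b x \<noteq> 0" "c x \<noteq> 0" using x n by (auto simp: norm_eq_iff)
    have "(a x, b x, c x) \<in> {(u, v, w). P u v w}" unfolding range[symmetric] by blast
    then have "(inverse (a x), inverse (b x), inverse (c x)) \<in> {(u, v, w). P u v w}"
      using inverse by simp
    then obtain y where "a y = inverse (a x)" "b y = inverse (b x)" "c y = inverse (c x)"
      unfolding range[symmetric] by auto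
    with nz have "1 = x * y" by (simp add: abc_eq_iff[of 1])
    then show ?thesis by (rule dvdI)
  qed
  then show eq: "{x. x dvd 1 \<and> alg_trace \<iota> x = s \<and> alg_norm \<iota> x = n} = {x. alg_trace \<iota> x = s \<and> alg_norm \<iota> x = n}"
    by blast
  have "{(u, v, w) \<in> trace_norm_triples s n. P u v w} =
      (\<lambda>x. (a x, b x, c x)) ` {x. alg_trace \<iota> x = s \<and> alg_norm \<iota> x = n}"
  proof (rule equalityI; rule subsetI)
    fix t assume "t \<in> {(u, v, w) \<in> trace_norm_triples s n. P u v w}"
    then have t: "t \<in> trace_norm_triples s n" "t \<in> range (\<lambda>x. (a x, b x, c x))"
      unfolding range by auto
    then show "t \<in> (\<lambda>x. (a x, b x, c x)) ` {x. alg_trace \<iota> x = s \<and> alg_norm \<iota> x = n}"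
      by (auto simp: trace_norm_triples_def trace_eq_iff norm_eq_iff)
  next
    fix t assume t: "t \<in> (\<lambda>x. (a x, b x, c x)) ` {x. alg_trace \<iota> x = s \<and> alg_norm \<iota> x = n}"
    then have "t \<in> {(u, v, w). P u v w}" unfolding range[symmetric] by blast
    then show "t \<in> {(u, v, w) \<in> trace_norm_triples s n. P u v w}"
      using t by (auto simp: trace_norm_triples_def trace_eq_iff norm_eq_iff)
  qed
  moreover have "inj_on (\<lambda>x. (a x, b x, c x)) A" for A
    using abc_eq_iff by (auto simp: inj_on_def)
  ultimately show "N_B \<iota> s n = card {(u, v, w) \<in> trace_norm_triples s n. P u v w}"
    unfolding N_B_def eq by (simp add: card_image)
qed

text \<open>The point (x : z) of the projective space of B \<oplus> F. The scalar action is spelled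
  as in \<open>curve_points\<close>, so that \<open>proj_class_eq_iff\<close> applies.\<close>

definition pt :: "'b \<Rightarrow> 'a \<Rightarrow> (('a^3) \<times> 'a) set" where
  "pt x z = {(\<lambda>r (x, z). (r *s x, r * z)) r (coords \<iota> x, z) |r. r \<noteq> 0}"

lemma pt_eq_iff: "pt x z = pt y w \<longleftrightarrow> (\<exists>r. r \<noteq> 0 \<and> y = \<iota> r * x \<and> w = r * z)"
proof -
  have "pt x z = pt y w \<longleftrightarrow>
      (\<exists>r. r \<noteq> 0 \<and> (coords \<iota> y, w) = (\<lambda>r (x, z). (r *s x, r * z)) r (coords \<iota> x, z))"
    unfolding pt_def by (rule proj_class_eq_iff) (auto simp: vector_smult_assoc)
  also have "\<dots> \<longleftrightarrow> (\<exists>r. r \<noteq> 0 \<and> coords \<iota> y = coords \<iota> (\<iota> r * x) \<and> w = r * z)"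
    by (simp add: coords_scale)
  also have "\<dots> \<longleftrightarrow> (\<exists>r. r \<noteq> 0 \<and> y = \<iota> r * x \<and> w = r * z)"
    by (metis elem_coords)
  finally show ?thesis .
qed

lemma curve_points_eq:
  "curve_points \<iota> id s n =
     {pt x z |x z. (x \<noteq> 0 \<or> z \<noteq> 0) \<and> alg_trace \<iota> x = s * z \<and> alg_norm \<iota> x = n * z ^ 3}"
proof -
  have forms: "curve_forms \<iota> id s n (v, z) = 0 \<longleftrightarrow>
      alg_trace \<iota> (elem v) = s * z \<and> alg_norm \<iota> (elem v) = n * z ^ 3" for v z
    by (simp add: curve_forms_def alg_trace_elem alg_norm_elem zero_prod_def)
  have "curve_points \<iota> id s n = {pt (elem v) z |v z. (v \<noteq> 0 \<or> z \<noteq> 0) \<and> curve_forms \<iota> id s n (v, z) = 0}"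
    unfolding curve_points_def proj_points_def pt_def by (auto simp: zero_prod_def)
  also have "\<dots> = {pt x z |x z. (coords \<iota> x \<noteq> 0 \<or> z \<noteq> 0) \<and> curve_forms \<iota> id s n (coords \<iota> x, z) = 0}"
    by (metis (no_types, opaque_lifting) coords_elem elem_coords)
  also have "\<dots> = {pt x z |x z. (x \<noteq> 0 \<or> z \<noteq> 0) \<and> alg_trace \<iota> x = s * z \<and> alg_norm \<iota> x = n * z ^ 3}"
    by (simp add: forms flip: elem_eq_0_iff)
  finally show ?thesis .
qed

text \<open>A point with nonzero \<open>z\<close> has a unique representative with z = 1. At z = 0
  both forms lose their constants, leaving Tr(x) = Norm(x) = 0.\<close>

lemma card_curve_points:
  fixes s n :: 'a
  defines "A \<equiv> {x. alg_trace \<iota> x = s \<and> alg_norm \<iota> x = n}"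
    and "I \<equiv> {x. x \<noteq> 0 \<and> alg_trace \<iota> x = 0 \<and> alg_norm \<iota> x = 0}"
  shows "card (curve_points \<iota> id s n) = card A + card ((\<lambda>x. pt x 0) ` I)"
proof -
  have "curve_points \<iota> id s n = (\<lambda>x. pt x 1) ` A \<union> (\<lambda>x. pt x 0) ` I"
  proof (rule equalityI)
    show "(\<lambda>x. pt x 1) ` A \<union> (\<lambda>x. pt x 0) ` I \<subseteq> curve_points \<iota> id s n"
    proof
      fix L assume "L \<in> (\<lambda>x. pt x 1) ` A \<union> (\<lambda>x. pt x 0) ` I"
      then consider x where "x \<in> A" "L = pt x 1" | x where "x \<in> I" "L = pt x 0" by blast
      then show "L \<in> curve_points \<iota> id s n"
      proof cases
        case 1
        then show ?thesis unfolding curve_points_eq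
          by (intro CollectI exI[of _ x] exI[of _ 1]) (auto simp: A_def)
      next
        case 2
        then show ?thesis unfolding curve_points_eq
          by (intro CollectI exI[of _ x] exI[of _ 0]) (auto simp: I_def)
      qed
    qed
    show "curve_points \<iota> id s n \<subseteq> (\<lambda>x. pt x 1) ` A \<union> (\<lambda>x. pt x 0) ` I"
    proof
      fix L assume "L \<in> curve_points \<iota> id s n"
      then obtain x z where L: "L = pt x z" and xz: "x \<noteq> 0 \<or> z \<noteq> 0"
          and tn: "alg_trace \<iota> x = s * z" "alg_norm \<iota> x = n * z ^ 3"
        unfolding curve_points_eq by blast
      show "L \<in> (\<lambda>x. pt x 1) ` A \<union> (\<lambda>x. pt x 0) ` I"
      proof (cases "z = 0")
        case True
        then show ?thesis using L xz tn by (auto simp: I_def zero_power)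
      next
        case False
        have "\<iota> (inverse z) * x \<in> A"
          unfolding A_def mem_Collect_eq trace_scale norm_scale tn using False by (simp add: field_simps)
        moreover have "L = pt (\<iota> (inverse z) * x) 1"
          unfolding L pt_eq_iff using False by (intro exI[of _ "inverse z"]) simp
        ultimately show ?thesis by blast
      qed
    qed
  qed
  moreover have "(\<lambda>x. pt x 1) ` A \<inter> (\<lambda>x. pt x 0) ` I = {}"
    by (auto simp: pt_eq_iff)
  moreover have "inj_on (\<lambda>x. pt x 1) A"
    by (auto simp: inj_on_def pt_eq_iff)
  moreover have "finite (UNIV :: 'b set)"
    by (rule finite_surj[of "UNIV :: ('a^3) set" _ elem]) (simp_all add: subset_iff image_iff, metis elem_coords)
  then have "finite A" "finite I" by (auto intro: finite_subset)
  ultimately show ?thesis by (simp add: card_Un_disjoint card_image)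
qed

text \<open>Norm zero kills one image, trace zero makes the other two opposite, and they cannot
  vanish as x is nonzero. The points at infinity are thus labelled by the embedding that
  vanishes.\<close>

lemma infinite_point_cases:
  assumes "x \<noteq> 0" "alg_trace \<iota> x = 0" "alg_norm \<iota> x = 0"
  obtains "a x = 0" "b x \<noteq> 0" "c x = - b x" | "b x = 0" "a x \<noteq> 0" "c x = - a x"
    | "c x = 0" "a x \<noteq> 0" "b x = - a x"
proof -
  have sum: "a x + b x + c x = 0" and "a x * b x * c x = 0"
    using assms by (auto simp: trace_eq_iff norm_eq_iff)
  then consider "a x = 0" | "b x = 0" | "c x = 0" by auto
  then show thesis
  proof cases
    case 1
    then have "c x = - b x" using sum by (simp add: add_eq_0_iff)
    then show thesis using 1 assms(1) that(1) by (auto simp: abc_eq_iff[of x 0])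
  next
    case 2
    then have "c x = - a x" using sum by (simp add: add_eq_0_iff)
    then show thesis using 2 assms(1) that(2) by (auto simp: abc_eq_iff[of x 0])
  next
    case 3
    then have "b x = - a x" using sum by (simp add: add_eq_0_iff)
    then show thesis using 3 assms(1) that(3) by (auto simp: abc_eq_iff[of x 0])
  qed
qed

text \<open>The points are (0 : 1 : -1), (1 : 0 : -1) and (1 : -1 : 0), told apart by the position
  of the zero.\<close>

lemma card_infinite_points_split:
  assumes range: "range (\<lambda>x. (a x, b x, c x)) =
      {(u, v, w). u ^ CARD('a) = u \<and> v ^ CARD('a) = v \<and> w ^ CARD('a) = w}"
  shows "card ((\<lambda>x. pt x 0) ` {x. x \<noteq> 0 \<and> alg_trace \<iota> x = 0 \<and> alg_norm \<iota> x = 0}) = 3"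
proof -
  have ex: "\<exists>x. a x = to_ac u \<and> b x = to_ac v \<and> c x = to_ac w" for u v w
  proof -
    have "(to_ac u, to_ac v, to_ac w) \<in> range (\<lambda>x. (a x, b x, c x))"
      unfolding range by (simp add: frob_to_ac)
    then show ?thesis by auto
  qed
  obtain x1 where x1: "a x1 = 0" "b x1 = 1" "c x1 = - 1" using ex[of 0 1 "-1"] by auto
  obtain x2 where x2: "a x2 = 1" "b x2 = 0" "c x2 = - 1" using ex[of 1 0 "-1"] by auto
  obtain x3 where x3: "a x3 = 1" "b x3 = - 1" "c x3 = 0" using ex[of 1 "-1" 0] by auto
  have in_F: "\<exists>r. a x = to_ac r" "\<exists>r. b x = to_ac r" for x
  proof -
    have "(a x, b x, c x) \<in> {(u, v, w). u ^ CARD('a) = u \<and> v ^ CARD('a) = v \<and> w ^ CARD('a) = w}"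
      unfolding range[symmetric] by blast
    then show "\<exists>r. a x = to_ac r" "\<exists>r. b x = to_ac r" by (auto simp: frob_fixed_iff)
  qed
  have "(\<lambda>x. pt x 0) ` {x. x \<noteq> 0 \<and> alg_trace \<iota> x = 0 \<and> alg_norm \<iota> x = 0} = {pt x1 0, pt x2 0, pt x3 0}"
  proof (rule equalityI)
    show "{pt x1 0, pt x2 0, pt x3 0} \<subseteq> (\<lambda>x. pt x 0) ` {x. x \<noteq> 0 \<and> alg_trace \<iota> x = 0 \<and> alg_norm \<iota> x = 0}"
      using x1 x2 x3 by (auto simp: trace_eq_iff norm_eq_iff abc_eq_iff[of _ 0])
    show "(\<lambda>x. pt x 0) ` {x. x \<noteq> 0 \<and> alg_trace \<iota> x = 0 \<and> alg_norm \<iota> x = 0} \<subseteq> {pt x1 0, pt x2 0, pt x3 0}"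
    proof (rule image_subsetI, elim CollectE conjE)
      fix x assume "x \<noteq> 0" "alg_trace \<iota> x = 0" "alg_norm \<iota> x = 0"
      then show "pt x 0 \<in> {pt x1 0, pt x2 0, pt x3 0}"
      proof (cases rule: infinite_point_cases)
        case 1
        obtain r where r: "b x = to_ac r" using in_F by blast
        then have "x = \<iota> r * x1" "r \<noteq> 0" using 1 x1 by (auto simp: abc_eq_iff[of x])
        then have "pt x1 0 = pt x 0" unfolding pt_eq_iff by auto
        then show ?thesis by simp
      next
        case 2
        obtain r where r: "a x = to_ac r" using in_F by blast
        then have "x = \<iota> r * x2" "r \<noteq> 0" using 2 x2 by (auto simp: abc_eq_iff[of x])
        then have "pt x2 0 = pt x 0" unfolding pt_eq_iff by auto
        then show ?thesis by simp
      next
        case 3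
        obtain r where r: "a x = to_ac r" using in_F by blast
        then have "x = \<iota> r * x3" "r \<noteq> 0" using 3 x3 by (auto simp: abc_eq_iff[of x])
        then have "pt x3 0 = pt x 0" unfolding pt_eq_iff by auto
        then show ?thesis by simp
      qed
    qed
  qed
  moreover have "pt x1 0 \<noteq> pt x2 0" "pt x1 0 \<noteq> pt x3 0" "pt x2 0 \<noteq> pt x3 0"
    using x1 x2 x3 by (auto simp: pt_eq_iff abc_eq_iff[of _ "_ * _"])
  ultimately show ?thesis by simp
qed

end

text \<open>A (q-1)-th root of -1 in the closure. It generates over F the elements that Frobenius
  negates, which are those of trace zero in the quadratic extension.\<close>

lemma ex_frob_eq_minus: "\<exists>t :: 'a::{field,finite} alg_closure. t \<noteq> 0 \<and> t ^ CARD('a) = - t"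
proof -
  have q: "CARD('a) \<ge> 2" by (rule card_field_ge_2)
  obtain t :: "'a alg_closure" where t: "t ^ (CARD('a) - 1) = - 1"
    using nth_root_exists[of "CARD('a) - 1" "- 1"] q by auto
  have "t ^ CARD('a) = t * t ^ (CARD('a) - 1)"
    using q by (simp flip: power_Suc)
  moreover have "t \<noteq> 0" using t q by (auto simp: zero_power)
  ultimately show ?thesis using t by auto
qed

context labelled_cubic_algebra
begin

text \<open>Frobenius exchanges \<open>b\<close> and \<open>c\<close>, so if one vanishes at
  \<open>x\<close> both do. Only the point where \<open>a\<close> vanishes remains, represented by
  (0, t, -t).\<close>

lemma card_infinite_points_swap:
  assumes range: "range (\<lambda>x. (a x, b x, c x)) =
      {(u, v, w). u ^ CARD('a) = u \<and> v ^ CARD('a) = w \<and> w ^ CARD('a) = v}"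
  shows "card ((\<lambda>x. pt x 0) ` {x. x \<noteq> 0 \<and> alg_trace \<iota> x = 0 \<and> alg_norm \<iota> x = 0}) = 1"
proof -
  obtain t :: "'a alg_closure" where t: "t \<noteq> 0" "t ^ CARD('a) = - t"
    using ex_frob_eq_minus by blast
  have "(0, t, - t) \<in> range (\<lambda>x. (a x, b x, c x))"
    unfolding range using t by (simp add: frob_minus zero_power)
  then obtain x1 where x1: "a x1 = 0" "b x1 = t" "c x1 = - t" by auto
  have frob: "b x ^ CARD('a) = c x" "c x ^ CARD('a) = b x" for x
  proof -
    have "(a x, b x, c x) \<in> {(u, v, w). u ^ CARD('a) = u \<and> v ^ CARD('a) = w \<and> w ^ CARD('a) = v}"
      unfolding range[symmetric] by blast
    then show "b x ^ CARD('a) = c x" "c x ^ CARD('a) = b x" by auto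
  qed
  have "pt x 0 = pt x1 0" if "x \<noteq> 0" "alg_trace \<iota> x = 0" "alg_norm \<iota> x = 0" for x
    using that
  proof (cases rule: infinite_point_cases)
    case 1
    \<comment> \<open>Frobenius negates both numerator and denominator, so the quotient lies in
      F.\<close>
    have "(b x / t) ^ CARD('a) = b x / t"
      using frob(1)[of x] 1 t by (simp add: power_divide)
    then obtain r where r: "b x / t = to_ac r" by (auto simp: frob_fixed_iff)
    then have "b x = to_ac r * t" using t by (simp add: field_simps)
    then have "x = \<iota> r * x1" "r \<noteq> 0" using 1 x1 by (auto simp: abc_eq_iff[of x])
    then have "pt x1 0 = pt x 0" unfolding pt_eq_iff by auto
    then show ?thesis by simp
  next
    case 2
    then show ?thesis using frob(1)[of x] by (simp add: zero_power)
  next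
    case 3
    then show ?thesis using frob(2)[of x] by (simp add: zero_power)
  qed
  moreover have "x1 \<noteq> 0" "alg_trace \<iota> x1 = 0" "alg_norm \<iota> x1 = 0"
    using x1 t by (auto simp: trace_eq_iff norm_eq_iff)
  ultimately have "(\<lambda>x. pt x 0) ` {x. x \<noteq> 0 \<and> alg_trace \<iota> x = 0 \<and> alg_norm \<iota> x = 0} = {pt x1 0}"
    by blast
  then show ?thesis by simp
qed

text \<open>Frobenius carries the vanishing of one image to the other two, forcing x = 0.\<close>

lemma card_infinite_points_cycle:
  assumes range: "range (\<lambda>x. (a x, b x, c x)) =
      {(u, v, w). u ^ CARD('a) = v \<and> v ^ CARD('a) = w \<and> w ^ CARD('a) = u}"
  shows "card ((\<lambda>x. pt x 0) ` {x. x \<noteq> 0 \<and> alg_trace \<iota> x = 0 \<and> alg_norm \<iota> x = 0}) = 0"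
proof -
  have frob: "a x ^ CARD('a) = b x" "b x ^ CARD('a) = c x" "c x ^ CARD('a) = a x" for x
  proof -
    have "(a x, b x, c x) \<in> {(u, v, w). u ^ CARD('a) = v \<and> v ^ CARD('a) = w \<and> w ^ CARD('a) = u}"
      unfolding range[symmetric] by blast
    then show "a x ^ CARD('a) = b x" "b x ^ CARD('a) = c x" "c x ^ CARD('a) = a x" by auto
  qed
  have False if "x \<noteq> 0" "alg_trace \<iota> x = 0" "alg_norm \<iota> x = 0" for x
    using that by (cases rule: infinite_point_cases) (use frob[of x] in \<open>auto simp: zero_power\<close>)
  then have "{x. x \<noteq> 0 \<and> alg_trace \<iota> x = 0 \<and> alg_norm \<iota> x = 0} = {}" by blast
  then show ?thesis by (simp only: image_empty card.empty)
qed

end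

section \<open>Smoothness and density of the affine part\<close>

lemma homogeneous_form_scale:
  "homogeneous_form d f \<Longrightarrow> f (r *s x, r * z) = r ^ d * f (x, z)"
  by (induction rule: homogeneous_form.induct) (auto simp: algebra_simps power_add)

text \<open>The relation is monic quadratic in \<open>w\<close>, so polynomials in \<open>z\<close>
  and \<open>w\<close> reduce modulo it to combinations of 1 and \<open>w\<close> over K[z]. Only
  products need the reduction.\<close>

lemma homogeneous_form_on_branch:
  fixes s n :: "'k::field" and u0 u1 u2 :: "'k^3"
  assumes "homogeneous_form d f"
  shows "\<exists>A B. \<forall>z w. w * w = (s * z - 1) * w - n * z ^ 3 \<longrightarrow>
     f (u0 + z *s u1 + w *s u2, z) = poly A z + poly B z * w"
  using assms
proof (induction rule: homogeneous_form.induct)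
  case (const c)
  show ?case by (intro exI[of _ "[:c:]"] exI[of _ 0]) simp
next
  case (coord i)
  show ?case by (intro exI[of _ "[:u0$i, u1$i:]"] exI[of _ "[:u2$i:]"]) (simp add: mult.commute)
next
  case last_coord
  show ?case by (intro exI[of _ "[:0, 1:]"] exI[of _ 0]) simp
next
  case (add d f g)
  then obtain A B C D where "\<forall>z w. w * w = (s * z - 1) * w - n * z ^ 3 \<longrightarrow>
      f (u0 + z *s u1 + w *s u2, z) = poly A z + poly B z * w"
    "\<forall>z w. w * w = (s * z - 1) * w - n * z ^ 3 \<longrightarrow>
      g (u0 + z *s u1 + w *s u2, z) = poly C z + poly D z * w" by blast
  then show ?case
    by (intro exI[of _ "A + C"] exI[of _ "B + D"]) (auto simp: algebra_simps)
next
  case (mult d f e g)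
  then obtain A B C D where AB: "\<And>z w. w * w = (s * z - 1) * w - n * z ^ 3 \<Longrightarrow>
      f (u0 + z *s u1 + w *s u2, z) = poly A z + poly B z * w"
    and CD: "\<And>z w. w * w = (s * z - 1) * w - n * z ^ 3 \<Longrightarrow>
      g (u0 + z *s u1 + w *s u2, z) = poly C z + poly D z * w" by blast
  show ?case
  proof (intro exI allI impI)
    fix z w assume w: "w * w = (s * z - 1) * w - n * z ^ 3"
    have "(poly A z + poly B z * w) * (poly C z + poly D z * w) =
        poly A z * poly C z + (poly A z * poly D z + poly B z * poly C z) * w + poly B z * poly D z * (w * w)"
      by (simp add: algebra_simps)
    also have "\<dots> = poly (A * C - B * D * Polynomial.monom n 3) z
        + poly (A * D + B * C + B * D * [:- 1, s:]) z * w"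
      unfolding w by (simp add: poly_monom algebra_simps)
    finally show "f (u0 + z *s u1 + w *s u2, z) * g (u0 + z *s u1 + w *s u2, z) =
        poly (A * C - B * D * Polynomial.monom n 3) z + poly (A * D + B * C + B * D * [:- 1, s:]) z * w"
      by (simp only: AB[OF w] CD[OF w])
  qed
qed

lemma ex_quadratic_roots:
  fixes p q :: "'k::alg_closed_field"
  shows "\<exists>w1 w2. w1 + w2 = p \<and> w1 * w2 = q"
proof -
  have "\<exists>w. poly [:q, - p, 1:] w = 0"
    by (rule alg_closed_imp_poly_has_root) simp
  then obtain w where "poly [:q, - p, 1:] w = 0" by blast
  then have "w + (p - w) = p \<and> w * (p - w) = q" by (simp add: algebra_simps)
  then show ?thesis by blast
qed

text \<open>
  In the coordinates \<open>(1, sz - 1 - w, w, z)\<close> the curve near a point at infinity is the double cover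
  \<open>w^2 = (sz - 1) w - n z^3\<close> of the \<open>z\<close>-line, which is unramified for almost all \<open>z\<close>. A form on it
  reads \<open>A(z) + B(z) w\<close>, so vanishing at both points over almost every \<open>z\<close> forces \<open>A = B = 0\<close>.
\<close>

lemma homogeneous_form_branch_vanish:
  fixes s n :: "'k::alg_closed_field" and u0 u1 u2 :: "'k^3"
  assumes f: "homogeneous_form d f"
    and vanish: "\<And>z w. z \<noteq> 0 \<Longrightarrow> w * w = (s * z - 1) * w - n * z ^ 3 \<Longrightarrow>
      f (u0 + z *s u1 + w *s u2, z) = 0"
  shows "f (u0, 0) = 0"
proof -
  obtain A B where AB: "\<And>z w. w * w = (s * z - 1) * w - n * z ^ 3 \<Longrightarrow>
     f (u0 + z *s u1 + w *s u2, z) = poly A z + poly B z * w"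
    using homogeneous_form_on_branch[OF f, of s n u0 u1 u2] by blast
  \<comment> \<open>The discriminant of the quadratic in \<open>w\<close>. Its value 1 at z = 0
    shows that only finitely many fibres are ramified.\<close>
  define D where "D = [:- 1, s:] ^ 2 - Polynomial.monom (4 * n) 3"
  have "poly D 0 = 1" by (simp add: D_def poly_monom)
  then have "D \<noteq> 0" by auto
  then have fin: "finite {z. poly D z = 0}" by (rule poly_roots_finite)
  have "poly A z = 0" if "z \<notin> insert 0 {z. poly D z = 0}" for z
  proof -
    have z: "z \<noteq> 0" "poly D z \<noteq> 0" using that by auto
    obtain w1 w2 where w: "w1 + w2 = s * z - 1" "w1 * w2 = n * z ^ 3"
      using ex_quadratic_roots by blast
    have "w1 * w1 = (s * z - 1) * w1 - n * z ^ 3" "w2 * w2 = (s * z - 1) * w2 - n * z ^ 3"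
      unfolding w[symmetric] by (simp_all add: algebra_simps)
    then have eq: "poly A z + poly B z * w1 = 0" "poly A z + poly B z * w2 = 0"
      using AB vanish z(1) by metis+
    have "poly D z = (s * z - 1) ^ 2 - 4 * (n * z ^ 3)"
      by (simp add: D_def poly_monom poly_power algebra_simps)
    also have "\<dots> = (w1 - w2) ^ 2"
      unfolding w[symmetric] by (simp add: power2_eq_square algebra_simps)
    finally have "w1 \<noteq> w2" using z(2) by auto
    moreover have "poly B z * (w1 - w2) = (poly A z + poly B z * w1) - (poly A z + poly B z * w2)"
      by (simp add: algebra_simps)
    then have "poly B z * (w1 - w2) = 0" unfolding eq by simp
    ultimately show ?thesis using eq by simp
  qed
  then have sub: "- insert 0 {z. poly D z = 0} \<subseteq> {z. poly A z = poly 0 z}" by auto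
  have "infinite (- insert 0 {z. poly D z = 0})"
    using fin infinite_alg_closed_field[where 'k = 'k] by (metis finite_compl finite_insert)
  then have "A = 0"
    using sub by (intro poly_eqI_infinite) (metis finite_subset)
  \<comment> \<open>The point at infinity is z = w = 0, where the form takes the value A(0).\<close>
  then show ?thesis using AB[of 0 0] by simp
qed

text \<open>The rows (1,1,1) and (x,y,z) are independent unless x = y = z. Two unknowns with
  different coefficients already suffice, and the third is set to 0.\<close>

lemma ex_linear_system:
  fixes x y z p r :: "'k::field"
  assumes "x \<noteq> y \<or> y \<noteq> z \<or> x \<noteq> z"
  shows "\<exists>u v w. u + v + w = p \<and> x * u + y * v + z * w = r"
proof -
  have two: "\<exists>u v. u + v = p \<and> x * u + y * v = r" if "x \<noteq> y" for x y
  proof -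
    have "x * ((r - y * p) / (x - y)) + y * (p - (r - y * p) / (x - y)) =
        (x - y) * ((r - y * p) / (x - y)) + y * p"
      by (simp only: ring_distribs) simp
    also have "\<dots> = r" using that by simp
    finally show ?thesis
      by (intro exI[of _ "(r - y * p) / (x - y)"] exI[of _ "p - (r - y * p) / (x - y)"]) simp
  qed
  consider "x \<noteq> y" | "y \<noteq> z" | "x \<noteq> z" using assms by blast
  then show ?thesis
  proof cases
    case 1
    then obtain u v where "u + v = p" "x * u + y * v = r" using two by blast
    then show ?thesis by (intro exI[of _ u] exI[of _ v] exI[of _ 0]) simp
  next
    case 2
    then obtain u v where "u + v = p" "y * u + z * v = r" using two by blast
    then show ?thesis by (intro exI[of _ 0] exI[of _ u] exI[of _ v]) simp
  next
    case 3
    then obtain u v where "u + v = p" "x * u + z * v = r" using two by blast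
    then show ?thesis by (intro exI[of _ u] exI[of _ 0] exI[of _ v]) simp
  qed
qed

section \<open>Jacobian criterion and density in the coordinates of K^3\<close>

context split_cubic_algebra
begin

lemma curve_forms_ac:
  "curve_forms \<iota> to_ac s n (x, z) = 0 \<longleftrightarrow>
     \<phi> x $ 1 + \<phi> x $ 2 + \<phi> x $ 3 = to_ac s * z \<and> \<phi> x $ 1 * \<phi> x $ 2 * \<phi> x $ 3 = to_ac n * z ^ 3"
  by (simp add: curve_forms_def phi_trace_det zero_prod_def)

lemma bc_matrix_pencil:
  "bc_matrix \<iota> (\<lambda>a. [:to_ac a:]) (\<chi> i. [:x$i, y$i:]) $ i $ j =
     [:bc_matrix \<iota> to_ac x $ i $ j, bc_matrix \<iota> to_ac y $ i $ j:]"
  by (simp add: bc_matrix_def sum_3 mult.commute)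

lemma bc_matrix_add_scale:
  "bc_matrix \<iota> to_ac (x + r *s y) $ i $ j = bc_matrix \<iota> to_ac x $ i $ j + r * bc_matrix \<iota> to_ac y $ i $ j"
  by (simp add: bc_matrix_def sum.distrib sum_distrib_left algebra_simps)

text \<open>At each r in K both sides evaluate to the norm of x + r y, and K is infinite.\<close>

lemma det_pencil:
  "det (bc_matrix \<iota> (\<lambda>a. [:to_ac a:]) (\<chi> i. [:x$i, y$i:])) =
     [:\<phi> x $ 1, \<phi> y $ 1:] * [:\<phi> x $ 2, \<phi> y $ 2:] * [:\<phi> x $ 3, \<phi> y $ 3:]" (is "?l = ?r")
proof -
  have "poly ?l r = poly ?r r" for r
  proof -
    have "poly ?l r = det (bc_matrix \<iota> to_ac (x + r *s y))"
      unfolding det_3 bc_matrix_pencil bc_matrix_add_scale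
      by (simp only: poly_add poly_diff poly_mult poly_pCons poly_0 mult_zero_right add_0_right)
    also have "\<dots> = poly ?r r"
      unfolding phi_trace_det phi_add phi_scale
      by (simp only: vector_add_component vector_smult_component poly_mult poly_pCons poly_0
          mult_zero_right add_0_right)
    finally show ?thesis .
  qed
  then have "{r. poly ?l r = poly ?r r} = UNIV" by auto
  then show ?thesis
    using infinite_alg_closed_field[where 'k = "'a alg_closure"] by (intro poly_eqI_infinite) metis
qed

lemma curve_differential_eq:
  "curve_differential \<iota> s n (x, z) (y, w) =
     (\<phi> y $ 1 + \<phi> y $ 2 + \<phi> y $ 3 - to_ac s * w,
      \<phi> x $ 2 * \<phi> x $ 3 * \<phi> y $ 1 + \<phi> x $ 1 * \<phi> x $ 3 * \<phi> y $ 2 + \<phi> x $ 1 * \<phi> x $ 2 * \<phi> y $ 3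
        - 3 * to_ac n * z\<^sup>2 * w)"
proof -
  have "Polynomial.coeff (trace (bc_matrix \<iota> (\<lambda>a. [:to_ac a:]) (\<chi> i. [:x$i, y$i:]))) 1 =
      trace (bc_matrix \<iota> to_ac y)"
    by (simp add: trace_def bc_matrix_pencil coeff_sum)
  then show ?thesis
    by (simp add: curve_differential_def curve_forms_def det_pencil phi_trace_det
        power2_eq_square power3_eq_cube algebra_simps)
qed

text \<open>Directions with w = 0 suffice: there the gradients are (1,1,1) and (bc, ac, ab). If they
  were dependent, then at z = 0 all of a, b, c would vanish, and elsewhere a = b = c would give s^3
  = 27n.\<close>

lemma surj_curve_differential:
  assumes sn: "s ^ 3 \<noteq> 27 * n" "n \<noteq> 0"
    and v: "v \<noteq> 0" "curve_forms \<iota> to_ac s n v = 0"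
  shows "surj (curve_differential \<iota> s n v)"
proof -
  obtain x z where xz: "v = (x, z)" by (cases v)
  define a b c where "a = \<phi> x $ 1" and "b = \<phi> x $ 2" and "c = \<phi> x $ 3"
  have sum: "a + b + c = to_ac s * z" and prod: "a * b * c = to_ac n * z ^ 3"
    using v(2) by (simp_all add: xz curve_forms_ac a_def b_def c_def)
  have "b * c \<noteq> a * c \<or> a * c \<noteq> a * b \<or> b * c \<noteq> a * b"
  proof (rule ccontr)
    assume "\<not> ?thesis"
    then have eq: "b * c = a * c" "a * c = a * b" by auto
    show False
    proof (cases "z = 0")
      case True
      then have "a = 0 \<and> b = 0 \<and> c = 0" using eq sum prod by auto
      then have "\<phi> x = \<phi> 0" by (simp add: vec_eq_iff forall_3 a_def b_def c_def)
      then have "x = 0" by (simp only: phi_eq_iff)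
      with True v(1) show False by (simp add: xz zero_prod_def)
    next
      case False
      then have "a * b * c \<noteq> 0" using prod sn(2) by simp
      then have "b = a" "c = a" using eq by auto
      then have "3 * a = to_ac s * z" "a ^ 3 = to_ac n * z ^ 3"
        using sum prod by (simp_all add: power3_eq_cube)
      then have "(to_ac s * z) ^ 3 = 27 * (to_ac n * z ^ 3)"
        by (simp flip: \<open>3 * a = to_ac s * z\<close> \<open>a ^ 3 = to_ac n * z ^ 3\<close> add: power_mult_distrib)
      then have "to_ac s ^ 3 * z ^ 3 = 27 * to_ac n * z ^ 3"
        by (simp add: power_mult_distrib)
      then have "to_ac (s ^ 3) = to_ac (27 * n)" using False by simp
      then show False using sn(1) by (simp only: to_ac_eq_iff)
    qed
  qed
  note ex = ex_linear_system[OF this]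
  have "\<exists>yw. curve_differential \<iota> s n v yw = (p, r)" for p r
  proof -
    obtain u v' w where uvw: "u + v' + w = p" "b * c * u + a * c * v' + a * b * w = r"
      using ex by blast
    have "curve_differential \<iota> s n v (inv_into UNIV \<phi> (vector [u, v', w]), 0) = (p, r)"
      using uvw by (simp add: xz curve_differential_eq a_def b_def c_def)
    then show ?thesis by blast
  qed
  then show ?thesis unfolding surj_def by (metis surj_pair)
qed

text \<open>Points with nonzero \<open>z\<close> scale into the affine part. A point at infinity is,
  up to scaling, (1, -1, 0) in some order of coordinates, and is reached along the double
  cover.\<close>

lemma affine_part_dense:
  assumes f: "homogeneous_form d f"
    and vanish: "\<And>x. curve_forms \<iota> to_ac s n (x, 1) = 0 \<Longrightarrow> f (x, 1) = 0"
    and v: "v \<noteq> 0" "curve_forms \<iota> to_ac s n v = 0"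
  shows "f v = 0"
proof -
  have affine: "f (x, z) = 0" if xz: "curve_forms \<iota> to_ac s n (x, z) = 0" "z \<noteq> 0" for x z
  proof -
    have "curve_forms \<iota> to_ac s n (inverse z *s x, 1) = 0"
      using xz unfolding curve_forms_ac phi_scale by (simp add: field_simps power3_eq_cube)
    then have "f (inverse z *s x, 1) = 0" by (rule vanish)
    moreover have "f (x, z) = z ^ d * f (inverse z *s x, 1)"
      using homogeneous_form_scale[OF f, of z "inverse z *s x" 1] xz(2) by (simp add: vector_smult_assoc)
    ultimately show ?thesis by simp
  qed
  have infinity: "f (x, 0) = 0"
    if ijk: "i \<noteq> j" "j \<noteq> k" "i \<noteq> k" and x: "\<phi> x $ j = - \<phi> x $ i" "\<phi> x $ k = 0" for x i j k
  proof -
    \<comment> \<open>Chosen so that \<open>u0 + z *s u1 + w *s u2\<close> has coordinates 1, sz - 1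
      - w, w at i, j, k. The trace equation then holds identically and the norm equation is the
      quadratic relation for \<open>w\<close>.\<close>
    define u0 u1 u2 where "u0 = inv_into UNIV \<phi> (axis i 1 - axis j 1)"
      and "u1 = inv_into UNIV \<phi> (axis j (to_ac s))" and "u2 = inv_into UNIV \<phi> (axis k 1 - axis j 1)"
    have U: "UNIV = {i, j, k}" by (rule sym, rule card_seteq) (use ijk in auto)
    have all: "(\<forall>l. P l) \<longleftrightarrow> P i \<and> P j \<and> P k" for P
      using U by (metis (full_types) UNIV_I insertE singletonD)
    have forms: "curve_forms \<iota> to_ac s n (y, z) = 0 \<longleftrightarrow> \<phi> y $ i + \<phi> y $ j + \<phi> y $ k = to_ac s * z \<and>
        \<phi> y $ i * \<phi> y $ j * \<phi> y $ k = to_ac n * z ^ 3" for y z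
    proof -
      have "\<phi> y $ 1 + \<phi> y $ 2 + \<phi> y $ 3 = (\<Sum>l\<in>UNIV. \<phi> y $ l)"
        by (simp add: sum_3)
      also have "\<dots> = \<phi> y $ i + \<phi> y $ j + \<phi> y $ k"
        unfolding U using ijk by (simp add: add.assoc)
      finally have 1: "\<phi> y $ 1 + \<phi> y $ 2 + \<phi> y $ 3 = \<phi> y $ i + \<phi> y $ j + \<phi> y $ k" .
      have "\<phi> y $ 1 * \<phi> y $ 2 * \<phi> y $ 3 = (\<Prod>l\<in>UNIV. \<phi> y $ l)"
        unfolding UNIV_3 by (simp add: mult.assoc)
      also have "\<dots> = \<phi> y $ i * \<phi> y $ j * \<phi> y $ k"
        unfolding U using ijk by (simp add: mult.assoc)
      finally show ?thesis unfolding curve_forms_ac 1 by simp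
    qed
    have "f (u0, 0) = 0"
    proof (rule homogeneous_form_branch_vanish[OF f])
      fix z w assume z: "z \<noteq> 0" and w: "w * w = (to_ac s * z - 1) * w - to_ac n * z ^ 3"
      define y where "y = u0 + z *s u1 + w *s u2"
      have y: "\<phi> y $ i = 1" "\<phi> y $ j = to_ac s * z - 1 - w" "\<phi> y $ k = w"
        using ijk by (auto simp: y_def phi_add phi_scale u0_def u1_def u2_def axis_def)
      have "curve_forms \<iota> to_ac s n (y, z) = 0"
        unfolding forms y using w by (simp add: algebra_simps)
      then show "f (u0 + z *s u1 + w *s u2, z) = 0"
        using affine z unfolding y_def by blast
    qed
    moreover have "\<phi> x = \<phi> ((\<phi> x $ i) *s u0)"
      using ijk x by (simp add: phi_scale u0_def vec_eq_iff all axis_def)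
    then have "x = (\<phi> x $ i) *s u0" by (simp only: phi_eq_iff)
    then have "f (x, 0) = (\<phi> x $ i) ^ d * f (u0, 0)"
      using homogeneous_form_scale[OF f, of "\<phi> x $ i" u0 0] by simp
    ultimately show ?thesis by simp
  qed
  obtain x z where xz: "v = (x, z)" by (cases v)
  show ?thesis
  proof (cases "z = 0")
    case False
    then show ?thesis using affine v(2) by (simp add: xz)
  next
    case True
    then have sum: "\<phi> x $ 1 + \<phi> x $ 2 + \<phi> x $ 3 = 0" and "\<phi> x $ 1 * \<phi> x $ 2 * \<phi> x $ 3 = 0"
      using v(2) unfolding xz curve_forms_ac by simp_all
    then consider "\<phi> x $ 1 = 0" | "\<phi> x $ 2 = 0" | "\<phi> x $ 3 = 0" by auto
    then have "f (x, 0) = 0"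
    proof cases
      case 1
      then have "\<phi> x $ 3 = - \<phi> x $ 2" using sum by (simp add: add_eq_0_iff)
      with 1 show ?thesis by (intro infinity[of 2 3 1]) simp_all
    next
      case 2
      then have "\<phi> x $ 3 = - \<phi> x $ 1" using sum by (simp add: add_eq_0_iff)
      with 2 show ?thesis by (intro infinity[of 1 3 2]) simp_all
    next
      case 3
      then have "\<phi> x $ 2 = - \<phi> x $ 1" using sum by (simp add: add_eq_0_iff)
      with 3 show ?thesis by (intro infinity[of 1 2 3]) simp_all
    qed
    then show ?thesis by (simp add: xz True)
  qed
qed

lemma smooth_compactification:
  assumes "s ^ 3 \<noteq> 27 * n" "n \<noteq> 0"
  shows "smooth_compactification \<iota> s n"
  unfolding smooth_compactification_def
  using surj_curve_differential[OF assms] affine_part_dense by blast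

end

section \<open>The three types of algebras\<close>

lemma algebra_hom_id_embedding:
  fixes \<iota> :: "'a::{field,finite} \<Rightarrow> 'b::comm_ring_1"
  assumes "algebra_hom \<iota> id f"
  shows "(\<lambda>x. to_ac (f x)) \<in> geom_embeddings \<iota>"
  using assms by (simp add: geom_embeddings_def algebra_hom_def unital_hom_def)

text \<open>Two different embeddings fixed by Frobenius, which is impossible for a transposition or
  a 3-cycle.\<close>

lemma iso_split_embeddings:
  fixes \<iota> :: "'a::{field,finite} \<Rightarrow> 'b::comm_ring_1"
  assumes "iso_split \<iota>"
  obtains \<sigma> \<rho> where "\<sigma> \<in> geom_embeddings \<iota>" "\<rho> \<in> geom_embeddings \<iota>" "\<sigma> \<noteq> \<rho>"
    "\<And>x. \<sigma> x ^ CARD('a) = \<sigma> x" "\<And>x. \<rho> x ^ CARD('a) = \<rho> x"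
proof -
  obtain f g h :: "'b \<Rightarrow> 'a" where fgh: "algebra_hom \<iota> id f" "algebra_hom \<iota> id g" "bij (\<lambda>x. (f x, g x, h x))"
    using assms by (auto simp: iso_split_def)
  obtain x where "(0, 1, 1) = (f x, g x, h x)"
    using bij_is_surj[OF fgh(3)] by (rule surjE)
  then have "to_ac (f x) \<noteq> to_ac (g x)" by auto
  then have "(\<lambda>x. to_ac (f x)) \<noteq> (\<lambda>x. to_ac (g x))" by metis
  then show thesis
    using algebra_hom_id_embedding fgh(1,2) by (intro that) (auto simp: frob_to_ac)
qed

text \<open>One embedding fixed by Frobenius excludes the 3-cycle, one that is moved excludes the
  identity. An element mapping to t with t^q = -t witnesses the second.\<close>

lemma iso_linear_quadratic_embeddings:
  fixes \<iota> :: "'a::{field,finite} \<Rightarrow> 'b::comm_ring_1"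
  assumes "iso_linear_quadratic \<iota>" and two: "(2::'a) \<noteq> 0"
  obtains \<sigma> \<rho> x where "\<sigma> \<in> geom_embeddings \<iota>" "\<rho> \<in> geom_embeddings \<iota>"
    "\<And>x. \<sigma> x ^ CARD('a) = \<sigma> x" "\<rho> x ^ CARD('a) \<noteq> \<rho> x"
proof -
  obtain f g where fg: "algebra_hom \<iota> id f" "algebra_hom \<iota> to_ac g"
      "bij_betw (\<lambda>x. (f x, g x)) UNIV (UNIV \<times> Fq_ext 2)"
    using assms by (auto simp: iso_linear_quadratic_def)
  obtain t :: "'a alg_closure" where t: "t \<noteq> 0" "t ^ CARD('a) = - t"
    using ex_frob_eq_minus by blast
  have "t \<in> Fq_ext 2"
    using t by (simp add: Fq_ext_def power2_eq_square power_mult frob_minus)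
  then have "(0, t) \<in> (\<lambda>x. (f x, g x)) ` UNIV"
    unfolding bij_betw_imp_surj_on[OF fg(3)] by simp
  then obtain x where x: "g x = t" by auto
  have "(2 :: 'a alg_closure) \<noteq> 0"
    by (metis two to_ac_eq_0_iff to_ac_numeral)
  then have "t + t \<noteq> 0" using t by (simp flip: mult_2)
  then have "- t \<noteq> t" by (metis neg_eq_iff_add_eq_0)
  then show thesis
    using algebra_hom_id_embedding[OF fg(1)] fg(2) x t
    by (intro that[of "\<lambda>x. to_ac (f x)" g x]) (auto simp: frob_to_ac geom_embeddings_def)
qed

text \<open>This excludes the identity and the transposition, where (1,0,0) and (0,1,1) come from
  elements of B with product zero.\<close>

lemma iso_cubic_field_no_zero_divisors:
  fixes \<iota> :: "'a::{field,finite} \<Rightarrow> 'b::comm_ring_1" and x y :: 'b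
  assumes "iso_cubic_field \<iota>" "x * y = 0"
  shows "x = 0 \<or> y = 0"
proof -
  obtain g where g: "algebra_hom \<iota> to_ac g" "bij_betw g UNIV (Fq_ext 3)"
    using assms by (auto simp: iso_cubic_field_def)
  have inj: "inj g" using g(2) by (rule bij_betw_imp_inj_on)
  have add: "g (u + v) = g u + g v" and mult: "g (u * v) = g u * g v" for u v
    using g(1) by (auto simp: algebra_hom_def unital_hom_def)
  have g0: "g 0 = 0" using add[of 0 0] by (metis add.right_neutral add_cancel_right_right)
  have "g x * g y = 0" using mult[of x y] assms(2) g0 by simp
  then have "g x = g 0 \<or> g y = g 0" using g0 by auto
  then show ?thesis using inj by (auto simp: inj_def)
qed

lemma (in labelled_cubic_algebra) frob_perm_apply:
  "frob_perm \<iota> a = (\<lambda>x. a x ^ CARD('a))" "frob_perm \<iota> b = (\<lambda>x. b x ^ CARD('a))"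
  "frob_perm \<iota> c = (\<lambda>x. c x ^ CARD('a))" "\<sigma> \<notin> {a, b, c} \<Longrightarrow> frob_perm \<iota> \<sigma> = \<sigma>"
  by (simp_all add: frob_perm_def embeddings)

theorem theorem2p8:
  fixes \<iota> :: "'a::{field,finite} \<Rightarrow> 'b::comm_ring_1" and s n :: 'a
  assumes "CHAR('a) \<noteq> 2" and "CHAR('a) \<noteq> 3"
    and "n \<noteq> 0" and "s ^ 3 \<noteq> 27 * n"
    and "etale_cubic \<iota>"
  shows "smooth_compactification \<iota> s n
    \<and> int (card (curve_points \<iota> id s n)) =
        int CARD('a) + 1 + sign (frob_perm \<iota>) * A_q s n
    \<and> int (N_B \<iota> s n) =
        int CARD('a) + 1 + sign (frob_perm \<iota>) * A_q s n
          - int (card {\<sigma> \<in> geom_embeddings \<iota>. frob_perm \<iota> \<sigma> = \<sigma>})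
    \<and> (iso_split \<iota> \<longrightarrow>
        int (N_B \<iota> s n) = int (card (weierstrass_points s n)) - 3)
    \<and> (iso_linear_quadratic \<iota> \<longrightarrow>
        int (N_B \<iota> s n) = 2 * int CARD('a) + 1 - int (card (weierstrass_points s n)))
    \<and> (iso_cubic_field \<iota> \<longrightarrow>
        int (N_B \<iota> s n) = int (card (weierstrass_points s n)))"
proof -
  have two: "(2::'a) \<noteq> 0"
  proof
    assume "(2::'a) = 0"
    then have "CHAR('a) dvd 2" by (metis of_nat_eq_0_iff_char_dvd of_nat_numeral)
    then have "CHAR('a) = 1 \<or> CHAR('a) = 2" using two_is_prime_nat by (auto simp: prime_nat_iff)
    then show False using assms(1) by auto
  qed
  note counts = card_frob_triples[OF assms(4) two assms(3)]
  obtain \<phi> where "split_cubic_algebra \<iota> \<phi>" using etale_cubic_obtain[OF assms(5)] .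
  then interpret split_cubic_algebra \<iota> \<phi> .
  have smooth: "smooth_compactification \<iota> s n"
    using assms(3,4) by (intro smooth_compactification)
  from assms(5) show ?thesis
  proof (cases rule: etale_cubic_frob_cases)
    case (split a b c)
    interpret labelled_cubic_algebra \<iota> a b c by unfold_locales (rule split(1))
    have frob: "a x ^ CARD('a) = a x" "b x ^ CARD('a) = b x" "c x ^ CARD('a) = c x" for x
    proof -
      have "(a x, b x, c x) \<in> range (\<lambda>x. (a x, b x, c x))" by blast
      then show "a x ^ CARD('a) = a x" "b x ^ CARD('a) = b x" "c x ^ CARD('a) = c x"
        unfolding split(2) by auto
    qed
    have "frob_perm \<iota> \<sigma> = \<sigma>" for \<sigma>
      using frob_perm_apply(4)[of \<sigma>] by (cases "\<sigma> \<in> {a, b, c}") (auto simp: frob_perm_apply frob)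
    then have "frob_perm \<iota> = id" "{\<sigma> \<in> geom_embeddings \<iota>. frob_perm \<iota> \<sigma> = \<sigma>} = {a, b, c}"
      by (auto simp: embeddings)
    moreover have "card {a, b, c} = 3" using distinct by simp
    ultimately have "sign (frob_perm \<iota>) = 1" "card {\<sigma> \<in> geom_embeddings \<iota>. frob_perm \<iota> \<sigma> = \<sigma>} = 3"
      by (simp_all only: sign_id)
    moreover note N = N_B_eq[OF split(2), of n s]
    then have "int (N_B \<iota> s n) = int (card (weierstrass_points s n)) - 3"
      using assms(3) counts(1) by (simp add: power_inverse)
    moreover have "card (curve_points \<iota> id s n) = N_B \<iota> s n + 3"
      using N assms(3) unfolding card_curve_points card_infinite_points_split[OF split(2)] N_B_def
      by (simp add: power_inverse)
    \<comment> \<open>The cycle type of Frobenius excludes the other two isomorphism types, so their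
      implications hold vacuously; the remaining cases proceed alike.\<close>
    moreover have "\<not> iso_linear_quadratic \<iota>"
    proof
      assume "iso_linear_quadratic \<iota>"
      then obtain \<rho> x where "\<rho> \<in> geom_embeddings \<iota>" "\<rho> x ^ CARD('a) \<noteq> \<rho> x"
        using two by (rule iso_linear_quadratic_embeddings)
      then show False using frob by (auto simp: embeddings)
    qed
    moreover have "\<not> iso_cubic_field \<iota>"
    proof
      assume *: "iso_cubic_field \<iota>"
      have "(1, 0, 0) \<in> range (\<lambda>x. (a x, b x, c x))" "(0, 1, 1) \<in> range (\<lambda>x. (a x, b x, c x))"
        unfolding split(2) by (simp_all add: zero_power)
      then obtain x y where "a x = 1" "b x = 0" "c x = 0" "a y = 0" "b y = 1" "c y = 1" by auto
      then show False using iso_cubic_field_no_zero_divisors[OF *, of x y]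
        by (auto simp: abc_eq_iff[of _ 0])
    qed
    ultimately show ?thesis using smooth by (simp add: A_q_def)
  next
    case (swap a b c)
    interpret labelled_cubic_algebra \<iota> a b c by unfold_locales (rule swap(1))
    have frob: "a x ^ CARD('a) = a x" "b x ^ CARD('a) = c x" "c x ^ CARD('a) = b x" for x
    proof -
      have "(a x, b x, c x) \<in> range (\<lambda>x. (a x, b x, c x))" by blast
      then show "a x ^ CARD('a) = a x" "b x ^ CARD('a) = c x" "c x ^ CARD('a) = b x"
        unfolding swap(2) by auto
    qed
    have p: "frob_perm \<iota> a = a" "frob_perm \<iota> b = c" "frob_perm \<iota> c = b"
      by (auto simp: frob_perm_apply frob)
    have "frob_perm \<iota> \<sigma> = Transposition.transpose b c \<sigma>" for \<sigma>
      using frob_perm_apply(4)[of \<sigma>] distinct by (cases "\<sigma> \<in> {a, b, c}") (auto simp: p)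
    then have "frob_perm \<iota> = Transposition.transpose b c" by blast
    then have "sign (frob_perm \<iota>) = - 1" using distinct by (simp add: sign_swap_id)
    moreover have "{\<sigma> \<in> geom_embeddings \<iota>. frob_perm \<iota> \<sigma> = \<sigma>} = {a}"
      using p distinct by (auto simp: embeddings)
    then have "card {\<sigma> \<in> geom_embeddings \<iota>. frob_perm \<iota> \<sigma> = \<sigma>} = 1" by simp
    moreover note N = N_B_eq[OF swap(2), of n s]
    then have "int (N_B \<iota> s n) = 2 * int CARD('a) + 1 - int (card (weierstrass_points s n))"
      using assms(3) counts(2) by (simp add: power_inverse)
    moreover have "card (curve_points \<iota> id s n) = N_B \<iota> s n + 1"
      using N assms(3) unfolding card_curve_points card_infinite_points_swap[OF swap(2)] N_B_def
      by (simp add: power_inverse)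
    moreover have "\<not> iso_split \<iota>"
    proof
      assume "iso_split \<iota>"
      then obtain \<sigma> \<rho> where *: "\<sigma> \<in> geom_embeddings \<iota>" "\<rho> \<in> geom_embeddings \<iota>" "\<sigma> \<noteq> \<rho>"
        "\<And>x. \<sigma> x ^ CARD('a) = \<sigma> x" "\<And>x. \<rho> x ^ CARD('a) = \<rho> x"
        using iso_split_embeddings by blast
      have "\<sigma> = a" if "\<sigma> \<in> geom_embeddings \<iota>" "\<And>x. \<sigma> x ^ CARD('a) = \<sigma> x" for \<sigma>
        using that frob distinct by (auto simp: fun_eq_iff embeddings)
      from this[OF *(1,4)] this[OF *(2,5)] *(3) show False by simp
    qed
    moreover have "\<not> iso_cubic_field \<iota>"
    proof
      assume *: "iso_cubic_field \<iota>"
      have "(1, 0, 0) \<in> range (\<lambda>x. (a x, b x, c x))" "(0, 1, 1) \<in> range (\<lambda>x. (a x, b x, c x))"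
        unfolding swap(2) by (simp_all add: zero_power)
      then obtain x y where "a x = 1" "b x = 0" "c x = 0" "a y = 0" "b y = 1" "c y = 1" by auto
      then show False using iso_cubic_field_no_zero_divisors[OF *, of x y]
        by (auto simp: abc_eq_iff[of _ 0])
    qed
    ultimately show ?thesis using smooth by (simp add: A_q_def)
  next
    case (cycle a b c)
    interpret labelled_cubic_algebra \<iota> a b c by unfold_locales (rule cycle(1))
    have frob: "a x ^ CARD('a) = b x" "b x ^ CARD('a) = c x" "c x ^ CARD('a) = a x" for x
    proof -
      have "(a x, b x, c x) \<in> range (\<lambda>x. (a x, b x, c x))" by blast
      then show "a x ^ CARD('a) = b x" "b x ^ CARD('a) = c x" "c x ^ CARD('a) = a x"
        unfolding cycle(2) by auto
    qed
    have p: "frob_perm \<iota> a = b" "frob_perm \<iota> b = c" "frob_perm \<iota> c = a"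
      by (auto simp: frob_perm_apply frob)
    \<comment> \<open>The 3-cycle is written as two transpositions so that its sign can be read
      off.\<close>
    have "frob_perm \<iota> \<sigma> = (Transposition.transpose a b \<circ> Transposition.transpose b c) \<sigma>" for \<sigma>
      using frob_perm_apply(4)[of \<sigma>] distinct by (cases "\<sigma> \<in> {a, b, c}") (auto simp: p)
    then have "frob_perm \<iota> = Transposition.transpose a b \<circ> Transposition.transpose b c" by blast
    then have "sign (frob_perm \<iota>) = 1"
      using distinct by (simp add: sign_compose permutation_swap_id sign_swap_id)
    moreover have none: "\<not> (\<forall>x. \<sigma> x ^ CARD('a) = \<sigma> x)" if "\<sigma> \<in> geom_embeddings \<iota>" for \<sigma>
      using that frob distinct distinct[THEN not_sym] by (auto simp: embeddings fun_eq_iff)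
    have "{\<sigma> \<in> geom_embeddings \<iota>. frob_perm \<iota> \<sigma> = \<sigma>} = {}"
      using p distinct by (auto simp: embeddings)
    then have "card {\<sigma> \<in> geom_embeddings \<iota>. frob_perm \<iota> \<sigma> = \<sigma>} = 0" by (simp only: card.empty)
    moreover note N = N_B_eq[OF cycle(2), of n s]
    then have "int (N_B \<iota> s n) = int (card (weierstrass_points s n))"
      using assms(3) counts(3) by (simp add: power_inverse)
    moreover have "card (curve_points \<iota> id s n) = N_B \<iota> s n"
      using N assms(3) unfolding card_curve_points card_infinite_points_cycle[OF cycle(2)] N_B_def
      by (simp add: power_inverse)
    moreover have "\<not> iso_split \<iota>"
      using none iso_split_embeddings by blast
    moreover have "\<not> iso_linear_quadratic \<iota>"
      using none two iso_linear_quadratic_embeddings by blast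
    ultimately show ?thesis using smooth by (simp add: A_q_def)
  qed
qed



end
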